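(* Let $X$ be the generic symmetric $n\times n$ matrix, i.e. its entries are given by the variables $x_{ij}$ for $1\le i\le j\le n$ (with $x_{ji}=x_{ij}$). Then for every $0\le d\le n$ the hyperbolicity cone of the derivative $D_I^d\det(X)$ is a spectrahedral cone.
   Context: $I$ is the $n\times n$ identity matrix and $D_I^d$ is the $d$-fold directional derivative in direction $I$ of polynomial functions on the space $U$ of real symmetric $n\times n$ matrices. A homogeneous polynomial $h$ on $U$ is hyperbolic with respect to $I$ if $h(I)>0$ and for all $A\in U$ the polynomial $h(tI-A)\in\mathbb{R}[t]$ has only real roots; its hyperbolicity cone (at $I$) is the set of all $A\in U$ such that all zeros of $h(tI-A)$ are nonnegative. The polynomials $D_I^d\det(X)$ are hyperbolic with respect to $I$. A spectrahedral cone in $U$ is the preimage of the cone of positive semidefinite $N\times N$ real symmetric matrices under a linear map from $U$ to the space of real symmetric $N\times N$ matrices, for some $N$. *)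

theory Defs
  imports "HOL-Analysis.Derivative" "Jordan_Normal_Form.Determinant"
begin

definition sym_mats :: "nat \<Rightarrow> real mat set" where
  "sym_mats n = {A \<in> carrier_mat n n. transpose_mat A = A}"

(* Polynomials on the space of symmetric matrices are represented by the
   functions they induce. The derivative along E at A only involves values of
   p on the line A + t E, which stays in sym_mats n if A and E do. *)
definition dir_deriv :: "real mat \<Rightarrow> (real mat \<Rightarrow> real) \<Rightarrow> real mat \<Rightarrow> real" where
  "dir_deriv E p = (\<lambda>A. deriv (\<lambda>t::real. p (A + t \<cdot>\<^sub>m E)) 0)"

(* Intended for h hyperbolic with respect to the identity: then t \<mapsto> h (t I - A)
   is a nonzero polynomial with only real roots, so ranging over real t covers
   all of its zeros. *)
definition hyperbolicity_cone :: "nat \<Rightarrow> (real mat \<Rightarrow> real) \<Rightarrow> real mat set" where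
  "hyperbolicity_cone n h =
     {A \<in> sym_mats n. \<forall>t::real. h (t \<cdot>\<^sub>m 1\<^sub>m n - A) = 0 \<longrightarrow> t \<ge> 0}"

definition psd_mats :: "nat \<Rightarrow> real mat set" where
  "psd_mats N = {M \<in> sym_mats N. \<forall>v \<in> carrier_vec N. scalar_prod v (M *\<^sub>v v) \<ge> 0}"

definition linear_sym_map :: "nat \<Rightarrow> nat \<Rightarrow> (real mat \<Rightarrow> real mat) \<Rightarrow> bool" where
  "linear_sym_map n N L \<longleftrightarrow>
     L \<in> sym_mats n \<rightarrow> sym_mats N \<and>
     (\<forall>A \<in> sym_mats n. \<forall>B \<in> sym_mats n. L (A + B) = L A + L B) \<and>
     (\<forall>c::real. \<forall>A \<in> sym_mats n. L (c \<cdot>\<^sub>m A) = c \<cdot>\<^sub>m L A)"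

definition spectrahedral_cone :: "nat \<Rightarrow> real mat set \<Rightarrow> bool" where
  "spectrahedral_cone n C \<longleftrightarrow>
     (\<exists>N L. linear_sym_map n N L \<and> C = {A \<in> sym_mats n. L A \<in> psd_mats N})"

end

theory Submission
  imports Defs "Jordan_Normal_Form.Spectral_Radius" "HOL-Combinatorics.Multiset_Permutations"
begin

text \<open>
  With \<open>k = n - d\<close>, the derivative at \<open>X\<close> is \<open>d!\<close> times the elementary symmetric polynomial \<open>e\<^sub>k\<close> of
  the eigenvalues of \<open>X\<close>. For numbers, the ratios \<open>q\<^sub>k = e\<^sub>k / e\<^sub>k\<^sub>-\<^sub>1\<close> satisfy Braenden's recursion:
  \<open>k q\<^sub>k(x)\<close> is the sum over \<open>i\<close> of the conductance of \<open>x\<^sub>i\<close> in series with \<open>q\<^sub>k\<^sub>-\<^sub>1\<close> of the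
  remaining variables. Unfolding it expresses \<open>q\<^sub>k\<close> as the minimum of an energy that is linear in \<open>x\<close>, over potentials
  indexed by the subsets of size less than \<open>k\<close>. Here potentials are replaced by tensors that are
  alternating in their row indices and in their column indices (endomorphisms of exterior powers),
  and the energy by a quadratic form that is linear in \<open>X\<close> and invariant under simultaneous
  orthogonal changes of coordinates. After diagonalising \<open>X\<close>, completing squares along the recursion
  shows that the form is nonnegative when all \<open>e\<^sub>k(x + s)\<close> with \<open>s > 0\<close> are positive. Conversely, if
  \<open>e\<^sub>k(x + s) = 0\<close>, an explicit tensor on which the form at \<open>x + s\<close> vanishes is negative at \<open>x\<close>, since
  the form of the identity is positive on it.
\<close>

section \<open>Derivatives of real-rooted polynomials\<close>

text \<open>The obstacle is that the eigenvalues of \<open>X\<close> are not linear in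
  \<open>X\<close>, so an inequality that is linear in n numbers says nothing linear about
  \<open>X\<close> until it is freed from the choice of an eigenbasis. The price is an asymmetry: in
  an eigenbasis, nonnegativity still has to be shown for all alternating tensors, including those
  that mix different index sets, whereas a negative value is already found among the diagonal ones.

  The recursion comes from two identities for y = x + s: k e_k is the sum over i of y_i times
  e_(k-1) of the other variables, and e_(k-1) equals y_i e_(k-2) + e_(k-1) with both terms on the
  right taken in the other variables. Dividing the first by e_(k-1) gives k q_k as the sum of y_i q
  / (y_i + q), where q is the ratio q_(k-1) of the variables other than y_i. The y_i may have any
  sign; what must be positive are the denominators, that is, elementary symmetric polynomials after
  deleting variables. These are values of derivatives of real-rooted polynomials, and the interplay
  of their largest roots gives the positivity.\<close>

definition real_rooted :: "real poly \<Rightarrow> real multiset \<Rightarrow> bool" where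
  "real_rooted p A \<longleftrightarrow> (\<exists>c>0. p = smult c (\<Prod>a\<in>#A. [:-a, 1:]))"

lemma map_poly_of_real_linear_factors:
  "map_poly complex_of_real (\<Prod>a\<in>#A. [:-a, 1:]) = (\<Prod>a\<in>#A. [:-complex_of_real a, 1:])"
proof -
  interpret H: map_poly_inj_idom_hom complex_of_real ..
  show ?thesis by (induction A) (simp_all add: H.hom_mult hom_distribs del: mult_pCons_left)
qed

text \<open>The logarithmic derivative is the sum of the 1 / (z - a), and every summand has
  imaginary part of the sign opposite to Im z, so the sum cannot vanish off the real axis. Arguing
  this way avoids counting multiplicities with Rolle's theorem.\<close>

lemma Gauss_Lucas_real_rooted:
  fixes A :: "real multiset"
  assumes "Im z \<noteq> 0"
  defines "p \<equiv> map_poly complex_of_real (\<Prod>a\<in>#A. [:-a, 1:])"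
  shows "poly p z \<noteq> 0 \<and> (A \<noteq> {#} \<longrightarrow> Im (poly (pderiv p) z / poly p z) * Im z < 0)"
  unfolding p_def
proof (induction A)
  case empty
  show ?case by simp
next
  case (add a A)
  define q where "q = map_poly complex_of_real (\<Prod>a\<in>#A. [:-a, 1:])"
  define w where "w = z - complex_of_real a"
  have w: "w \<noteq> 0" "Im w = Im z" using assms(1) by (auto simp: w_def complex_eq_iff)
  have q: "poly q z \<noteq> 0" using add by (simp add: q_def)
  have eq: "map_poly complex_of_real (\<Prod>a\<in>#add_mset a A. [:-a, 1:]) = [:-complex_of_real a, 1:] * q"
    unfolding q_def map_poly_of_real_linear_factors by simp
  have ratio: "poly (pderiv ([:-complex_of_real a, 1:] * q)) z / poly ([:-complex_of_real a, 1:] * q) z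
      = inverse w + poly (pderiv q) z / poly q z"
  proof -
    have "poly (pderiv ([:-complex_of_real a, 1:] * q)) z = w * poly (pderiv q) z + poly q z"
      unfolding pderiv_mult by (simp add: pderiv_pCons w_def algebra_simps)
    moreover have "poly ([:-complex_of_real a, 1:] * q) z = w * poly q z"
      by (simp add: w_def algebra_simps)
    ultimately show ?thesis using w q by (simp only:) (simp add: field_simps)
  qed
  moreover have "Im (inverse w) * Im z < 0"
  proof -
    have "(Re w)\<^sup>2 + (Im w)\<^sup>2 > 0"
      using w assms(1) by (simp add: add_nonneg_pos)
    hence "(Im w)\<^sup>2 / ((Re w)\<^sup>2 + (Im w)\<^sup>2) > 0"
      using w(2) assms(1) by (intro divide_pos_pos) auto
    moreover have "Im (inverse w) * Im z = - ((Im w)\<^sup>2 / ((Re w)\<^sup>2 + (Im w)\<^sup>2))"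
      by (simp add: w(2)[symmetric] power2_eq_square)
    ultimately show ?thesis by linarith
  qed
  moreover have "Im (poly (pderiv q) z / poly q z) * Im z \<le> 0"
    using add unfolding q_def by (cases "A = {#}") auto
  ultimately show ?case
    unfolding eq ratio using q w
    by (simp add: distrib_right add_neg_nonpos w_def del: mult_pCons_left inverse_complex.simps)
qed

lemma real_rooted_pderiv:
  assumes "real_rooted p A" "A \<noteq> {#}"
  shows "\<exists>B. size B = size A - 1 \<and> real_rooted (pderiv p) B"
proof -
  interpret H: map_poly_inj_idom_hom complex_of_real ..
  obtain c where c: "c > 0" and p: "p = smult c (\<Prod>a\<in>#A. [:-a, 1:])"
    using assms(1) by (auto simp: real_rooted_def)
  define q where "q = (\<Prod>a\<in>#A. [:-a, 1:])"
  have lc: "lead_coeff q = 1" unfolding q_def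
    by (induction A) (auto simp: lead_coeff_mult simp del: mult_pCons_left)
  have q0: "q \<noteq> 0" using lc by auto
  have "degree q = size A \<and> q \<noteq> 0" unfolding q_def
    by (induction A) (auto simp: degree_mult_eq simp del: mult_pCons_left)
  hence deg: "degree q = size A" by simp
  define r where "r = pderiv q"
  have degr: "degree r = size A - 1" by (simp add: r_def degree_pderiv deg)
  have "degree q \<noteq> 0" using deg assms(2) by simp
  hence r0: "r \<noteq> 0" using pderiv_eq_0_iff[of q] by (simp add: r_def)
  have lcr: "lead_coeff r = size A"
    using lc deg assms(2) degr by (simp add: r_def coeff_pderiv nonempty_has_size)
  define rc where "rc = map_poly complex_of_real r"
  have rc0: "rc \<noteq> 0" using r0 by (simp add: rc_def)
  obtain B where B: "size B = degree rc" "rc = smult (lead_coeff rc) (\<Prod>x\<in>#B. [:-x, 1:])"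
    using alg_closed_imp_factorization[OF rc0] by auto
  have real: "Im b = 0" if "b \<in># B" for b
  proof (rule ccontr)
    assume b: "Im b \<noteq> 0"
    have "poly (\<Prod>x\<in>#B. [:-x, 1:]) b = 0"
      using that by (auto simp: poly_prod_mset)
    hence "poly rc b = 0" using B(2) by (metis mult_zero_right poly_smult)
    hence "poly (pderiv (map_poly complex_of_real q)) b = 0"
      by (simp add: rc_def r_def of_real_hom.map_poly_pderiv)
    thus False using Gauss_Lucas_real_rooted[OF b, of A] assms(2) by (simp add: q_def)
  qed
  define C where "C = image_mset Re B"
  have Beq: "B = image_mset complex_of_real C"
  proof -
    have "image_mset (\<lambda>b. complex_of_real (Re b)) B = image_mset (\<lambda>b. b) B"
      by (rule image_mset_cong) (use real in \<open>auto simp: complex_eq_iff\<close>)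
    thus ?thesis by (simp add: C_def multiset.map_comp o_def)
  qed
  have "(\<Prod>x\<in>#B. [:-x, 1:]) = map_poly complex_of_real (\<Prod>a\<in>#C. [:-a, 1:])"
    by (simp add: Beq map_poly_of_real_linear_factors multiset.map_comp o_def)
  moreover have "lead_coeff rc = complex_of_real (lead_coeff r)"
    by (simp add: rc_def)
  ultimately have "rc = map_poly complex_of_real (smult (lead_coeff r) (\<Prod>a\<in>#C. [:-a, 1:]))"
    using B(2) by (simp only: of_real_hom.map_poly_hom_smult)
  hence "r = smult (lead_coeff r) (\<Prod>a\<in>#C. [:-a, 1:])"
    unfolding rc_def by (simp only: H.eq_iff)
  hence "pderiv p = smult (c * real (size A)) (\<Prod>a\<in>#C. [:-a, 1:])"
    using p lcr by (metis pderiv_smult q_def r_def smult_smult)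
  moreover have "c * real (size A) > 0" using c assms(2) by (simp add: nonempty_has_size)
  ultimately have "real_rooted (pderiv p) C" unfolding real_rooted_def by blast
  moreover have "size C = size A - 1" using B(1) degr by (simp add: C_def rc_def)
  ultimately show ?thesis by blast
qed

lemma real_rooted_root_iff:
  assumes "real_rooted p A" shows "poly p t = 0 \<longleftrightarrow> t \<in># A"
  using assms by (auto simp: real_rooted_def poly_prod_mset prod_mset_zero_iff)

lemma real_rooted_pos:
  assumes "real_rooted p A" "\<And>a. a \<in># A \<Longrightarrow> a < t"
  shows "poly p t > 0" "A \<noteq> {#} \<Longrightarrow> poly (pderiv p) t > 0"
proof -
  obtain c where c: "c > 0" and p: "p = smult c (\<Prod>a\<in>#A. [:-a, 1:])"
    using assms(1) by (auto simp: real_rooted_def)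
  have *: "poly (\<Prod>a\<in>#A. [:-a, 1:]) t > 0 \<and> poly (pderiv (\<Prod>a\<in>#A. [:-a, 1:])) t \<ge> 0 \<and>
     (A \<noteq> {#} \<longrightarrow> poly (pderiv (\<Prod>a\<in>#A. [:-a, 1:])) t > 0)"
    using assms(2)
  proof (induction A)
    case (add a A)
    define q where "q = (\<Prod>a\<in>#A. [:-a, 1:])"
    have "poly q t > 0" "poly (pderiv q) t \<ge> 0" using add by (auto simp: q_def)
    moreover have "t > a" using add.prems by simp
    ultimately have "(t - a) * poly q t > 0" "(t - a) * poly (pderiv q) t + poly q t > 0"
      by (auto intro!: add_nonneg_pos mult_nonneg_nonneg)
    moreover have "poly ([:-a,1:] * q) t = (t - a) * poly q t" by (simp add: algebra_simps)
    moreover have "poly (pderiv ([:-a,1:] * q)) t = (t - a) * poly (pderiv q) t + poly q t"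
      unfolding pderiv_mult by (simp add: pderiv_pCons algebra_simps)
    moreover have "(\<Prod>a\<in>#add_mset a A. [:-a, 1:]) = [:-a,1:] * q" by (simp add: q_def)
    ultimately show ?case by (simp only:) simp
  qed simp
  show "poly p t > 0" "A \<noteq> {#} \<Longrightarrow> poly (pderiv p) t > 0"
    using * c by (auto simp: p pderiv_smult)
qed

lemma real_rooted_pos_imp:
  assumes "real_rooted p A" "\<And>t. t \<ge> s \<Longrightarrow> poly p t > 0" "a \<in># A"
  shows "a < s"
  using real_rooted_root_iff[OF assms(1), of a] assms(2)[of a] assms(3) by (cases "a < s") auto

text \<open>Up to a positive factor, the value at \<open>s\<close> of the following polynomial is the elementary
  symmetric polynomial of degree \<open>card S - d\<close> in the numbers \<open>x i + s\<close>, \<open>i \<in> S\<close>.\<close>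

definition dpoly :: "('a \<Rightarrow> real) \<Rightarrow> nat \<Rightarrow> 'a set \<Rightarrow> real poly" where
  "dpoly x d S = (pderiv ^^ d) (\<Prod>i\<in>S. [:x i, 1:])"

lemma pderiv_dpoly: "pderiv (dpoly x d S) = dpoly x (Suc d) S"
  by (simp add: dpoly_def)

lemma dpoly_Suc_sum:
  assumes "finite S"
  shows "dpoly x (Suc d) S = (\<Sum>u\<in>S. dpoly x d (S - {u}))"
  unfolding dpoly_def funpow_Suc_right o_def pderiv_prod higher_pderiv_sum
  by (simp add: pderiv_pCons)

lemma higher_pderiv_linear_mult:
  "(pderiv ^^ Suc d) ([:a, 1:] * p) = [:a, 1:] * (pderiv ^^ Suc d) p + smult (of_nat (Suc d)) ((pderiv ^^ d) p)"
proof (induction d)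
  case 0
  show ?case by (simp only: funpow.simps o_apply id_apply pderiv_mult) (simp add: pderiv_pCons)
next
  case (Suc d)
  have "(pderiv ^^ Suc (Suc d)) ([:a, 1:] * p) = pderiv ((pderiv ^^ Suc d) ([:a, 1:] * p))" by simp
  also have "\<dots> = pderiv ([:a, 1:] * (pderiv ^^ Suc d) p) + smult (of_nat (Suc d)) ((pderiv ^^ Suc d) p)"
    unfolding Suc.IH by (simp only: pderiv_add pderiv_smult funpow.simps o_def)
  also have "pderiv ([:a, 1:] * (pderiv ^^ Suc d) p) = [:a, 1:] * (pderiv ^^ Suc (Suc d)) p + (pderiv ^^ Suc d) p"
    unfolding pderiv_mult by (simp add: pderiv_pCons)
  finally show ?case by (simp add: smult_add_left algebra_simps)
qed

lemma poly_dpoly_0: "poly (dpoly x 0 S) s = (\<Prod>i\<in>S. x i + s)"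
  by (simp add: dpoly_def poly_prod)

text \<open>This is e_k = y_u e_(k-1) + e_k, with the variable u left out on the right. The factor d
  + 1 appears because derivatives of order d + 1 carry (d + 1)! and those of order d only
  d!.\<close>

lemma poly_dpoly_Suc:
  assumes "finite S" "u \<in> S"
  shows "poly (dpoly x (Suc d) S) s = (x u + s) * poly (dpoly x (Suc d) (S - {u})) s + (real d + 1) * poly (dpoly x d (S - {u})) s"
proof -
  have "(\<Prod>i\<in>S. [:x i, 1:]) = [:x u, 1:] * (\<Prod>i\<in>S - {u}. [:x i, 1:])"
    using assms by (simp add: prod.remove)
  thus ?thesis unfolding dpoly_def
    by (simp only: higher_pderiv_linear_mult) (simp add: algebra_simps)
qed

text \<open>With k = card S - d, this says that the sum of y_u times e_(k-1) of the other variables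
  is k e_k: each monomial is counted once for each of its k variables.\<close>

lemma dpoly_Euler:
  assumes "finite S"
  shows "(\<Sum>u\<in>S. (x u + s) * poly (dpoly x d (S - {u})) s) = (real (card S) - real d) * poly (dpoly x d S) s"
proof (cases d)
  case 0
  have "(\<Sum>u\<in>S. (x u + s) * poly (dpoly x 0 (S - {u})) s) = (\<Sum>u\<in>S. poly (dpoly x 0 S) s)"
    using assms by (intro sum.cong) (auto simp: poly_dpoly_0 prod.remove)
  thus ?thesis using 0 by simp
next
  case (Suc e)
  have "(\<Sum>u\<in>S. (x u + s) * poly (dpoly x d (S - {u})) s)
    = (\<Sum>u\<in>S. poly (dpoly x d S) s - (real e + 1) * poly (dpoly x e (S - {u})) s)"
    unfolding Suc by (intro sum.cong) (auto simp: poly_dpoly_Suc[OF assms])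
  also have "\<dots> = card S * poly (dpoly x d S) s - (real e + 1) * poly (\<Sum>u\<in>S. dpoly x e (S - {u})) s"
    by (simp add: sum_subtractf sum_distrib_left poly_sum)
  also have "(\<Sum>u\<in>S. dpoly x e (S - {u})) = dpoly x d S"
    unfolding Suc by (rule dpoly_Suc_sum[OF assms, symmetric])
  finally show ?thesis by (simp add: Suc algebra_simps)
qed

lemma dpoly_real_rooted:
  assumes "finite S" "d \<le> card S"
  shows "\<exists>A. size A = card S - d \<and> real_rooted (dpoly x d S) A"
  using assms(2)
proof (induction d)
  case 0
  have "(\<Prod>i\<in>S. [:x i, 1:]) = (\<Prod>a\<in>#image_mset (\<lambda>i. - x i) (mset_set S). [:-a, 1:])"
    by (simp add: prod_unfold_prod_mset multiset.map_comp o_def)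
  thus ?case
    by (intro exI[of _ "image_mset (\<lambda>i. - x i) (mset_set S)"])
      (auto simp: real_rooted_def dpoly_def intro!: exI[of _ 1])
next
  case (Suc d)
  then obtain A where A: "size A = card S - d" "real_rooted (dpoly x d S) A" by auto
  hence "A \<noteq> {#}" using Suc.prems by auto
  from real_rooted_pderiv[OF A(2) this] A(1) show ?case
    by (auto simp: pderiv_dpoly)
qed

lemma dpoly_eq_0:
  assumes "finite S" "card S < d"
  shows "dpoly x d S = 0"
proof -
  obtain A where A: "size A = card S - card S" "real_rooted (dpoly x (card S) S) A"
    using dpoly_real_rooted[OF assms(1), of "card S" x] by auto
  then obtain c where "dpoly x (card S) S = [:c:]" by (auto simp: real_rooted_def)
  hence zero: "dpoly x (Suc (card S)) S = 0" using pderiv_dpoly[of x "card S" S] by (simp add: pderiv_pCons)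
  have "d = (d - Suc (card S)) + Suc (card S)" using assms(2) by simp
  hence "dpoly x d S = (pderiv ^^ (d - Suc (card S))) (dpoly x (Suc (card S)) S)"
    unfolding dpoly_def by (metis funpow_add o_apply)
  also have "\<dots> = 0" unfolding zero by (rule higher_pderiv_0)
  finally show ?thesis .
qed

lemma dpoly_top_pos:
  assumes "finite S"
  shows "poly (dpoly x (card S) S) s > 0"
proof -
  obtain A where A: "size A = card S - card S" "real_rooted (dpoly x (card S) S) A"
    using dpoly_real_rooted[OF assms(1), of "card S" x] by auto
  thus ?thesis by (auto simp: real_rooted_def)
qed

lemma dpoly_Suc_pos:
  assumes "finite S" "d < card S" "\<And>t. t \<ge> s \<Longrightarrow> poly (dpoly x d S) t > 0" "t \<ge> s"
  shows "poly (dpoly x (Suc d) S) t > 0"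
proof -
  obtain A where A: "size A = card S - d" "real_rooted (dpoly x d S) A"
    using dpoly_real_rooted[OF assms(1), of d x] assms(2) by auto
  have "A \<noteq> {#}" using A(1) assms(2) by auto
  moreover have "a < t" if "a \<in># A" for a
    using real_rooted_pos_imp[OF A(2) assms(3) that] assms(4) by simp
  ultimately show ?thesis using real_rooted_pos(2)[OF A(2)] by (simp add: pderiv_dpoly)
qed

text \<open>For d > 0 let q be the derivative of order d - 1 without the variable u. At the largest
  root m of q', if m >= s, the recursion leaves only a positive multiple of q(m), so q(m) > 0.
  Beyond m the polynomial q increases, hence all roots of q lie below m, which forces q'(m) > 0, a
  contradiction.\<close>

lemma dpoly_remove_pos:
  assumes fin: "finite S" and u: "u \<in> S" and d: "d < card S"
    and pos: "\<And>t. t \<ge> s \<Longrightarrow> poly (dpoly x d S) t > 0" and t: "t \<ge> s"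
  shows "poly (dpoly x d (S - {u})) t > 0"
proof (cases d)
  case 0
  have "x i + t > 0" if "i \<in> S" for i
  proof (rule ccontr)
    assume "\<not> ?thesis"
    hence "- x i \<ge> s" using t by simp
    from pos[OF this] have "(\<Prod>j\<in>S. x j - x i) > 0" by (simp add: 0 poly_dpoly_0)
    moreover have "(\<Prod>j\<in>S. x j - x i) = 0" using fin that by (intro prod_zero) auto
    ultimately show False by simp
  qed
  thus ?thesis by (auto simp: 0 poly_dpoly_0 intro!: prod_pos)
next
  case (Suc e)
  let ?q = "dpoly x e (S - {u})"
  have card: "card (S - {u}) = card S - 1" using fin u by simp
  have "e \<le> card (S - {u})" using d Suc card by simp
  then obtain A where A: "size A = card (S - {u}) - e" "real_rooted ?q A"
    using dpoly_real_rooted[of "S - {u}" e x] fin d Suc card by auto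
  have A0: "A \<noteq> {#}" using A(1) card d Suc by auto
  obtain B where B: "real_rooted (dpoly x d (S - {u})) B"
    using real_rooted_pderiv[OF A(2) A0] by (auto simp: pderiv_dpoly Suc)
  have "b < s" if b: "b \<in># B" for b
  proof (rule ccontr)
    assume "\<not> b < s"
    define m where "m = Max (set_mset B)"
    have "m \<in># B" unfolding m_def using b by (intro Max_in) auto
    have m_ge: "a \<le> m" if "a \<in># B" for a unfolding m_def using that by (intro Max_ge) auto
    hence ms: "m \<ge> s" using b \<open>\<not> b < s\<close> by force
    have root: "poly (dpoly x d (S - {u})) m = 0"
      using real_rooted_root_iff[OF B] \<open>m \<in># B\<close> by simp
    have "(real e + 1) * poly ?q m > 0"
      using pos[OF ms] poly_dpoly_Suc[OF fin u, of x e m] root by (simp add: Suc)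
    hence qm: "poly ?q m > 0" by (simp add: zero_less_mult_iff)
    have qpos: "poly ?q r > 0" if "r \<ge> m" for r
    proof (cases "r = m")
      case False
      have "poly ?q m < poly ?q r"
      proof (rule DERIV_pos_imp_increasing_open[where f = "poly ?q"])
        show "m < r" using that False by simp
        fix y assume "m < y" "y < r"
        hence "poly (dpoly x d (S - {u})) y > 0"
          using m_ge by (intro real_rooted_pos(1)[OF B]) force
        thus "\<exists>z. ((poly ?q) has_real_derivative z) (at y) \<and> z > 0"
          using poly_DERIV[of ?q y] by (auto simp: pderiv_dpoly Suc)
      qed (auto intro!: continuous_intros)
      thus ?thesis using qm by simp
    qed (use qm in simp)
    have "poly (pderiv ?q) m > 0"
      using real_rooted_pos_imp[OF A(2) qpos] by (intro real_rooted_pos(2)[OF A(2) _ A0]) auto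
    thus False using root by (simp add: pderiv_dpoly Suc)
  qed
  thus ?thesis using t by (intro real_rooted_pos(1)[OF B]) force
qed

text \<open>This supplies the positive denominators of the ratios. The bound on
  \<open>card R\<close> keeps the degree card S - card R - (d + 1) from becoming negative.\<close>

lemma dpoly_Suc_diff_pos:
  assumes "finite S" "finite R" "R \<subseteq> S" "d + card R < card S" "\<And>t. t \<ge> s \<Longrightarrow> poly (dpoly x d S) t > 0" "t \<ge> s"
  shows "poly (dpoly x (Suc d) (S - R)) t > 0"
  using assms(2,3,4,6)
proof (induction R arbitrary: t rule: finite_induct)
  case empty
  thus ?case using dpoly_Suc_pos[OF assms(1) _ assms(5)] by simp
next
  case (insert u R)
  have "card (S - R) = card S - card R" using insert by (simp add: card_Diff_subset)
  hence "poly (dpoly x (Suc d) ((S - R) - {u})) t > 0"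
    using insert assms(1) by (intro dpoly_remove_pos[of "S - R" u "Suc d" s]) auto
  thus ?case by (simp only: Diff_insert[of S u R])
qed

lemma dpoly_pos_if_nonzero:
  assumes "finite S" "d \<le> card S" "\<And>t. t > 0 \<Longrightarrow> poly (dpoly x d S) t \<noteq> 0" "t > 0"
  shows "poly (dpoly x d S) t > 0"
proof -
  obtain A where A: "real_rooted (dpoly x d S) A"
    using dpoly_real_rooted[OF assms(1,2)] by blast
  have "a < t" if "a \<in># A" for a
    using real_rooted_root_iff[OF A, of a] assms(3)[of a] that assms(4) by (cases "a < t") auto
  thus ?thesis by (rule real_rooted_pos(1)[OF A])
qed

section \<open>Alternating tensors\<close>

definition words :: "nat \<Rightarrow> nat \<Rightarrow> nat list set" where
  "words n j = {xs. set xs \<subseteq> {..<n} \<and> length xs = j}"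

lemma finite_words [simp]: "finite (words n j)"
  unfolding words_def by (rule finite_lists_length_eq) simp

lemma words_0 [simp]: "words n 0 = {[]}"
  by (auto simp: words_def)

lemma sum_words_Suc: "(\<Sum>xs\<in>words n (Suc j). F xs) = (\<Sum>a<n. \<Sum>xs\<in>words n j. F (a # xs))"
proof -
  have "words n (Suc j) = (\<lambda>(a, xs). a # xs) ` ({..<n} \<times> words n j)"
    by (force simp: words_def length_Suc_conv image_iff)
  moreover have "inj_on (\<lambda>(a, xs). a # xs) ({..<n} \<times> words n j)"
    by (auto simp: inj_on_def)
  ultimately show ?thesis
    by (simp add: sum.reindex sum.cartesian_product case_prod_unfold)
qed

definition swap_at :: "nat \<Rightarrow> 'a list \<Rightarrow> 'a list" where
  "swap_at i xs = xs[i := xs ! Suc i, Suc i := xs ! i]"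

lemma length_swap_at [simp]: "length (swap_at i xs) = length xs"
  by (simp add: swap_at_def)

lemma swap_at_Cons [simp]: "swap_at (Suc i) (a # xs) = a # swap_at i xs" "swap_at 0 (a # b # xs) = b # a # xs"
  by (simp_all add: swap_at_def)

lemma nth_swap_at:
  "Suc i < length xs \<Longrightarrow> k < length xs \<Longrightarrow> swap_at i xs ! k = xs ! (if k = i then Suc i else if k = Suc i then i else k)"
  by (simp add: swap_at_def nth_list_update)

lemma mset_swap_at: "Suc i < length xs \<Longrightarrow> mset (swap_at i xs) = mset xs"
  unfolding swap_at_def by (rule mset_swap) auto

lemma set_swap_at: "Suc i < length xs \<Longrightarrow> set (swap_at i xs) = set xs"
  using mset_swap_at by (metis set_mset_mset)

lemma swap_at_swap_at: "Suc i < length xs \<Longrightarrow> swap_at i (swap_at i xs) = xs"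
  by (rule nth_equalityI) (auto simp: nth_swap_at)

lemma sum_words_swap_at:
  assumes "Suc i < j"
  shows "(\<Sum>xs\<in>words n j. F (swap_at i xs)) = (\<Sum>xs\<in>words n j. F xs)"
  using assms by (intro sum.reindex_bij_witness[of _ "swap_at i" "swap_at i"]) (auto simp: words_def swap_at_swap_at set_swap_at)

text \<open>Adjacent transpositions generate all permutations, so signs of permutations never have
  to be mentioned.\<close>

definition alternating :: "(nat list \<Rightarrow> real) \<Rightarrow> bool" where
  "alternating F \<longleftrightarrow> (\<forall>xs i. Suc i < length xs \<longrightarrow> F (swap_at i xs) = - F xs)"

lemma alternating_Cons: "alternating F \<Longrightarrow> alternating (\<lambda>xs. F (a # xs))"
  unfolding alternating_def by (metis Suc_less_eq length_Cons swap_at_Cons(1))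

text \<open>Adjacent swaps bring two equal letters next to each other and only change the sign; once
  they are neighbours, their swap fixes the word, so the value equals its negative.\<close>

lemma alternating_eq_0:
  assumes F: "alternating F" and xs: "\<not> distinct xs"
  shows "F xs = 0"
proof -
  have *: "F xs = 0" if "xs ! a = xs ! (Suc (a + m))" "Suc (a + m) < length xs" for xs a m
    using that
  proof (induction m arbitrary: xs)
    case 0
    hence "swap_at a xs = xs" by (intro nth_equalityI) (auto simp: nth_swap_at)
    thus ?case using F 0 by (auto simp: alternating_def dest!: spec[of _ xs] spec[of _ a])
  next
    case (Suc m)
    have "F (swap_at (Suc (a + m)) xs) = 0"
      using Suc.prems by (intro Suc.IH) (auto simp: nth_swap_at)
    moreover have "F (swap_at (Suc (a + m)) xs) = - F xs"
      using F Suc.prems by (simp add: alternating_def)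
    ultimately show ?case by simp
  qed
  obtain a b where "a < b" "b < length xs" "xs ! a = xs ! b"
    using xs by (metis distinct_conv_nth linorder_neqE_nat)
  thus ?thesis using *[of xs a "b - Suc a"] by simp
qed

text \<open>The square of \<open>F\<close> is invariant under adjacent swaps, so every position
  contributes as much as the first one. Words with a repeated letter, where a sum over
  \<open>set xs\<close> differs from a sum over positions, have value zero.\<close>

lemma alternating_sum_squares:
  assumes F: "alternating F"
  shows "(\<Sum>xs\<in>words n (Suc j). (\<Sum>u\<in>set xs. x u) * (F xs)\<^sup>2)
    = real (Suc j) * (\<Sum>a<n. x a * (\<Sum>xs\<in>words n j. (F (a # xs))\<^sup>2))"
proof -
  have pos: "(\<Sum>xs\<in>words n (Suc j). x (xs ! i) * (F xs)\<^sup>2) = (\<Sum>xs\<in>words n (Suc j). x (xs ! 0) * (F xs)\<^sup>2)"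
    if "i < Suc j" for i
    using that
  proof (induction i)
    case (Suc i)
    have "(\<Sum>xs\<in>words n (Suc j). x (xs ! Suc i) * (F xs)\<^sup>2)
      = (\<Sum>xs\<in>words n (Suc j). x (swap_at i xs ! i) * (F (swap_at i xs))\<^sup>2)"
      using Suc.prems F by (intro sum.cong) (auto simp: words_def nth_swap_at alternating_def)
    also have "\<dots> = (\<Sum>xs\<in>words n (Suc j). x (xs ! i) * (F xs)\<^sup>2)"
      using Suc.prems by (intro sum_words_swap_at[where F = "\<lambda>xs. x (xs ! i) * (F xs)\<^sup>2"]) simp
    finally show ?case using Suc by simp
  qed simp
  have "(\<Sum>xs\<in>words n (Suc j). (\<Sum>u\<in>set xs. x u) * (F xs)\<^sup>2)
    = (\<Sum>xs\<in>words n (Suc j). \<Sum>i<Suc j. x (xs ! i) * (F xs)\<^sup>2)"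
  proof (intro sum.cong refl)
    fix xs assume xs: "xs \<in> words n (Suc j)"
    show "(\<Sum>u\<in>set xs. x u) * (F xs)\<^sup>2 = (\<Sum>i<Suc j. x (xs ! i) * (F xs)\<^sup>2)"
    proof (cases "distinct xs")
      case True
      hence "(\<Sum>u\<in>set xs. x u) = sum_list (map x xs)" by (simp add: sum_list_distinct_conv_sum_set)
      also have "\<dots> = (\<Sum>i<Suc j. x (xs ! i))"
        using xs by (simp add: sum_list_sum_nth words_def atLeast0LessThan del: sum.lessThan_Suc)
      finally show ?thesis by (simp add: sum_distrib_right del: sum.lessThan_Suc)
    qed (use alternating_eq_0[OF F] in simp)
  qed
  also have "\<dots> = (\<Sum>i<Suc j. \<Sum>xs\<in>words n (Suc j). x (xs ! i) * (F xs)\<^sup>2)"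
    by (rule sum.swap)
  also have "\<dots> = (\<Sum>i<Suc j. \<Sum>xs\<in>words n (Suc j). x (xs ! 0) * (F xs)\<^sup>2)"
    by (rule sum.cong[OF refl], rule pos) simp
  also have "\<dots> = real (Suc j) * (\<Sum>xs\<in>words n (Suc j). x (xs ! 0) * (F xs)\<^sup>2)"
    by simp
  also have "(\<Sum>xs\<in>words n (Suc j). x (xs ! 0) * (F xs)\<^sup>2) = (\<Sum>a<n. x a * (\<Sum>xs\<in>words n j. (F (a # xs))\<^sup>2))"
    by (simp add: sum_words_Suc sum_distrib_left)
  finally show ?thesis .
qed

section \<open>The action of orthogonal matrices on tensors\<close>

text \<open>The transpose of \<open>V\<close> acts on every slot at once.\<close>

fun act1 :: "nat \<Rightarrow> (nat \<Rightarrow> nat \<Rightarrow> real) \<Rightarrow> (nat list \<Rightarrow> real) \<Rightarrow> nat list \<Rightarrow> real" where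
  "act1 n V F [] = F []"
| "act1 n V F (a # xs) = (\<Sum>b<n. V b a * act1 n V (\<lambda>zs. F (b # zs)) xs)"

lemma act1_sum: "act1 n V (\<lambda>zs. \<Sum>i\<in>I. c i * F i zs) xs = (\<Sum>i\<in>I. c i * act1 n V (F i) xs)"
proof (induction xs arbitrary: F)
  case (Cons a xs)
  have "act1 n V (\<lambda>zs. \<Sum>i\<in>I. c i * F i zs) (a # xs)
    = (\<Sum>b<n. \<Sum>i\<in>I. V b a * (c i * act1 n V (\<lambda>zs. F i (b # zs)) xs))"
    by (simp add: Cons.IH[of "\<lambda>i zs. F i (_ # zs)"] sum_distrib_left)
  also have "\<dots> = (\<Sum>i\<in>I. \<Sum>b<n. V b a * (c i * act1 n V (\<lambda>zs. F i (b # zs)) xs))"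
    by (rule sum.swap)
  also have "\<dots> = (\<Sum>i\<in>I. c i * act1 n V (F i) (a # xs))"
    by (simp add: sum_distrib_left mult_ac)
  finally show ?case .
qed simp

lemma act1_cong:
  "(\<And>zs. length zs = length xs \<Longrightarrow> F zs = G zs) \<Longrightarrow> act1 n V F xs = act1 n V G xs"
proof (induction xs arbitrary: F G)
  case (Cons a xs)
  have "act1 n V (\<lambda>zs. F (b # zs)) xs = act1 n V (\<lambda>zs. G (b # zs)) xs" for b
    by (rule Cons.IH) (simp add: Cons.prems)
  thus ?case by simp
qed simp

lemma act1_uminus: "act1 n V (\<lambda>zs. - F zs) xs = - act1 n V F xs"
  using act1_sum[of n V "\<lambda>_. - 1" "\<lambda>_. F" "{()}" xs] by simp

lemma act1_eq_0: "(\<And>zs. length zs = length xs \<Longrightarrow> F zs = 0) \<Longrightarrow> act1 n V F xs = 0"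
  using act1_cong[of xs F "\<lambda>_. 0"] act1_sum[of n V "\<lambda>_. 0" "\<lambda>_ _. 0" "{}" xs] by simp

text \<open>The same matrix acts in all slots, so the action commutes with swapping slots; for the
  first two slots this is an exchange of two sums.\<close>

lemma act1_alternating:
  assumes "alternating F"
  shows "alternating (act1 n V F)"
proof -
  have "act1 n V F (swap_at i xs) = - act1 n V F xs" if "Suc i < length xs" for i xs
    using that assms
  proof (induction xs arbitrary: i F)
    case (Cons a xs)
    show ?case
    proof (cases i)
      case (Suc i')
      have "act1 n V (\<lambda>zs. F (b # zs)) (swap_at i' xs) = - act1 n V (\<lambda>zs. F (b # zs)) xs" for b
        using Cons.prems Suc by (intro Cons.IH alternating_Cons) auto
      thus ?thesis using Suc by (simp add: sum_negf)
    next
      case 0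
      then obtain b ys where xs: "xs = b # ys" using Cons.prems by (cases xs) auto
      have neg: "F (d # c # zs) = - F (c # d # zs)" for c d zs
        using Cons.prems(2)[unfolded alternating_def, rule_format, of 0 "c # d # zs"] by simp
      have "act1 n V F (swap_at i (a # xs)) = (\<Sum>c<n. \<Sum>d<n. V c b * (V d a * act1 n V (\<lambda>zs. F (c # d # zs)) ys))"
        by (simp add: 0 xs sum_distrib_left)
      also have "\<dots> = (\<Sum>d<n. \<Sum>c<n. V c b * (V d a * act1 n V (\<lambda>zs. F (c # d # zs)) ys))"
        by (rule sum.swap)
      also have "\<dots> = (\<Sum>d<n. \<Sum>c<n. - (V d a * (V c b * act1 n V (\<lambda>zs. F (d # c # zs)) ys)))"
        by (subst (2) neg) (simp add: act1_uminus mult_ac)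
      also have "\<dots> = - act1 n V F (a # xs)"
        by (simp add: xs sum_negf sum_distrib_left)
      finally show ?thesis .
    qed
  qed simp
  thus ?thesis by (simp add: alternating_def)
qed

lemma sum4_rotate:
  "(\<Sum>a\<in>A. \<Sum>b\<in>B. (\<Sum>c\<in>C. \<Sum>d\<in>D. f a b c d)) = (\<Sum>c\<in>C. \<Sum>d\<in>D. \<Sum>a\<in>A. \<Sum>b\<in>B. f a b c d)"
proof -
  have "(\<Sum>a\<in>A. \<Sum>b\<in>B. \<Sum>c\<in>C. \<Sum>d\<in>D. f a b c d) = (\<Sum>a\<in>A. \<Sum>c\<in>C. \<Sum>b\<in>B. \<Sum>d\<in>D. f a b c d)"
    by (rule sum.cong[OF refl], rule sum.swap)
  also have "\<dots> = (\<Sum>c\<in>C. \<Sum>a\<in>A. \<Sum>b\<in>B. \<Sum>d\<in>D. f a b c d)"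
    by (rule sum.swap)
  also have "\<dots> = (\<Sum>c\<in>C. \<Sum>a\<in>A. \<Sum>d\<in>D. \<Sum>b\<in>B. f a b c d)"
    by (rule sum.cong[OF refl], rule sum.cong[OF refl], rule sum.swap)
  also have "\<dots> = (\<Sum>c\<in>C. \<Sum>d\<in>D. \<Sum>a\<in>A. \<Sum>b\<in>B. f a b c d)"
    by (rule sum.cong[OF refl], rule sum.swap)
  finally show ?thesis .
qed

text \<open>Orthonormality of the rows preserves inner products, that of the columns preserves the
  trace. Stating both makes passing to the transpose immediate.\<close>

definition orthonormal :: "nat \<Rightarrow> (nat \<Rightarrow> nat \<Rightarrow> real) \<Rightarrow> bool" where
  "orthonormal n V \<longleftrightarrow>
     (\<forall>b<n. \<forall>c<n. (\<Sum>a<n. V b a * V c a) = (if b = c then 1 else 0)) \<and>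
     (\<forall>b<n. \<forall>c<n. (\<Sum>a<n. V a b * V a c) = (if b = c then 1 else 0))"

lemma act1_inner:
  assumes V: "orthonormal n V"
  shows "(\<Sum>xs\<in>words n j. act1 n V F xs * act1 n V G xs) = (\<Sum>xs\<in>words n j. F xs * G xs)"
proof (induction j arbitrary: F G)
  case (Suc j)
  let ?F = "\<lambda>b. act1 n V (\<lambda>zs. F (b # zs))" and ?G = "\<lambda>b. act1 n V (\<lambda>zs. G (b # zs))"
  have "(\<Sum>xs\<in>words n (Suc j). act1 n V F xs * act1 n V G xs)
    = (\<Sum>a<n. \<Sum>xs\<in>words n j. \<Sum>b<n. \<Sum>c<n. V b a * V c a * (?F b xs * ?G c xs))"
    by (simp add: sum_words_Suc sum_product mult_ac)
  also have "\<dots> = (\<Sum>b<n. \<Sum>c<n. (\<Sum>a<n. \<Sum>xs\<in>words n j. V b a * V c a * (?F b xs * ?G c xs)))"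
    by (rule sum4_rotate)
  also have "\<dots> = (\<Sum>b<n. \<Sum>c<n. (\<Sum>a<n. V b a * V c a) * (\<Sum>xs\<in>words n j. ?F b xs * ?G c xs))"
    by (simp only: sum_product)
  also have "\<dots> = (\<Sum>b<n. \<Sum>c<n. if b = c then (\<Sum>xs\<in>words n j. F (b # xs) * G (c # xs)) else 0)"
    using V by (intro sum.cong refl) (auto simp: orthonormal_def Suc.IH)
  also have "\<dots> = (\<Sum>xs\<in>words n (Suc j). F xs * G xs)"
    by (simp add: sum_words_Suc)
  finally show ?case .
qed simp

type_synonym tensor = "nat list \<Rightarrow> nat list \<Rightarrow> real"

definition act2 :: "nat \<Rightarrow> (nat \<Rightarrow> nat \<Rightarrow> real) \<Rightarrow> tensor \<Rightarrow> tensor" where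
  "act2 n V T xs ys = act1 n V (\<lambda>zs. act1 n V (T zs) ys) xs"

lemma act2_Cons1: "act2 n V T (a # xs) ys = (\<Sum>b<n. V b a * act2 n V (\<lambda>xs. T (b # xs)) xs ys)"
  by (simp add: act2_def)

lemma act2_Cons2: "act2 n V T xs (a # ys) = (\<Sum>b<n. V b a * act2 n V (\<lambda>xs ys. T xs (b # ys)) xs ys)"
  by (simp add: act2_def act1_sum)

definition ip :: "nat \<Rightarrow> nat \<Rightarrow> nat \<Rightarrow> tensor \<Rightarrow> tensor \<Rightarrow> real" where
  "ip n j l F G = (\<Sum>xs\<in>words n j. \<Sum>ys\<in>words n l. F xs ys * G xs ys)"

lemma ip_act2:
  assumes V: "orthonormal n V"
  shows "ip n j l (act2 n V F) (act2 n V G) = ip n j l F G"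
proof -
  have "ip n j l (act2 n V F) (act2 n V G) = (\<Sum>ys\<in>words n l. \<Sum>xs\<in>words n j. act2 n V F xs ys * act2 n V G xs ys)"
    unfolding ip_def by (rule sum.swap)
  also have "\<dots> = (\<Sum>ys\<in>words n l. \<Sum>xs\<in>words n j. act1 n V (F xs) ys * act1 n V (G xs) ys)"
    unfolding act2_def act1_inner[OF V] ..
  also have "\<dots> = (\<Sum>xs\<in>words n j. \<Sum>ys\<in>words n l. act1 n V (F xs) ys * act1 n V (G xs) ys)"
    by (rule sum.swap)
  finally show ?thesis unfolding ip_def act1_inner[OF V] .
qed

lemma ip_sum_left:
  "ip n j l (\<lambda>xs ys. \<Sum>i\<in>I. c i * F i xs ys) G = (\<Sum>i\<in>I. c i * ip n j l (F i) G)"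
proof -
  have "ip n j l (\<lambda>xs ys. \<Sum>i\<in>I. c i * F i xs ys) G
    = (\<Sum>xs\<in>words n j. \<Sum>ys\<in>words n l. \<Sum>i\<in>I. c i * (F i xs ys * G xs ys))"
    by (simp add: ip_def sum_distrib_right mult.assoc)
  also have "\<dots> = (\<Sum>xs\<in>words n j. \<Sum>i\<in>I. \<Sum>ys\<in>words n l. c i * (F i xs ys * G xs ys))"
    by (intro sum.cong refl sum.swap)
  also have "\<dots> = (\<Sum>i\<in>I. \<Sum>xs\<in>words n j. \<Sum>ys\<in>words n l. c i * (F i xs ys * G xs ys))"
    by (rule sum.swap)
  finally show ?thesis by (simp add: ip_def sum_distrib_left)
qed

lemma ip_commute: "ip n j l F G = ip n j l G F"
  by (simp add: ip_def mult.commute)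

lemma ip_sum_right:
  "ip n j l G (\<lambda>xs ys. \<Sum>i\<in>I. c i * F i xs ys) = (\<Sum>i\<in>I. c i * ip n j l G (F i))"
  using ip_sum_left[of n j l c F I G] by (simp add: ip_commute)

lemma ip_sum2:
  "ip n j l (\<lambda>xs ys. \<Sum>i\<in>I. c i * F i xs ys) (\<lambda>xs ys. \<Sum>i\<in>J. d i * G i xs ys)
    = (\<Sum>i\<in>I. \<Sum>k\<in>J. c i * d k * ip n j l (F i) (G k))"
  by (simp add: ip_sum_left ip_sum_right sum_distrib_left mult.assoc)

section \<open>The quadratic form\<close>

definition slot_form :: "nat \<Rightarrow> (nat \<Rightarrow> nat \<Rightarrow> real) \<Rightarrow> nat \<Rightarrow> nat \<Rightarrow> tensor \<Rightarrow> tensor \<Rightarrow> real" where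
  "slot_form n X j l T T' = (\<Sum>a<n. \<Sum>b<n. X a b * ip n j l (\<lambda>xs. T (a # xs)) (\<lambda>xs. T' (b # xs)))"

text \<open>It pairs level j of the first tensor with level j + 1 of the second, so it is not
  symmetric in its two arguments.\<close>

definition cross_form :: "nat \<Rightarrow> (nat \<Rightarrow> nat \<Rightarrow> real) \<Rightarrow> nat \<Rightarrow> tensor \<Rightarrow> tensor \<Rightarrow> real" where
  "cross_form n X j T T' = (\<Sum>a<n. \<Sum>b<n. X a b * ip n j j T (\<lambda>xs ys. T' (a # xs) (b # ys)))"

definition level_weight :: "nat \<Rightarrow> nat \<Rightarrow> real" where
  "level_weight k j = fact (k - Suc j) / fact j"

text \<open>The summand for \<open>j\<close> is the polarised square norm of \<open>I \<otimes> T\<^sub>j - T\<^sub>j\<^sub>+\<^sub>1\<close>, antisymmetrised in the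
  column indices, with \<open>X\<close> acting on the first row index. For \<open>j = 0\<close> the truncated \<open>j - 1\<close> is harmless
  because of the factor \<open>j\<close>. The weights make the estimates for the levels \<open>j\<close> telescope.\<close>

definition tensor_form :: "nat \<Rightarrow> nat \<Rightarrow> (nat \<Rightarrow> nat \<Rightarrow> real) \<Rightarrow> tensor \<Rightarrow> tensor \<Rightarrow> real" where
  "tensor_form n k X T T' = (\<Sum>j<k. level_weight k j *
     ((\<Sum>a<n. X a a) * ip n j j T T' - real j * slot_form n X (j - 1) j T T'
       - 2 * cross_form n X j T T' + slot_form n X j (Suc j) T T' / (real j + 1)))"

definition conj_mat :: "nat \<Rightarrow> (nat \<Rightarrow> nat \<Rightarrow> real) \<Rightarrow> (nat \<Rightarrow> nat \<Rightarrow> real) \<Rightarrow> nat \<Rightarrow> nat \<Rightarrow> real" where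
  "conj_mat n V X = (\<lambda>a b. \<Sum>c<n. \<Sum>d<n. V a c * X c d * V b d)"

lemma sum_conj:
  "(\<Sum>a<n. \<Sum>b<n. X a b * (\<Sum>c<n. \<Sum>d<n. V c a * V d b * Z c d)) = (\<Sum>c<n. \<Sum>d<n. conj_mat n V X c d * Z c d)"
proof -
  have "(\<Sum>a<n. \<Sum>b<n. X a b * (\<Sum>c<n. \<Sum>d<n. V c a * V d b * Z c d))
    = (\<Sum>a<n. \<Sum>b<n. \<Sum>c<n. \<Sum>d<n. V c a * X a b * V d b * Z c d)"
    by (simp add: sum_distrib_left mult_ac)
  also have "\<dots> = (\<Sum>c<n. \<Sum>d<n. \<Sum>a<n. \<Sum>b<n. V c a * X a b * V d b * Z c d)"
    by (rule sum4_rotate)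
  finally show ?thesis by (simp add: conj_mat_def sum_distrib_right)
qed

lemma trace_conj:
  assumes "orthonormal n V"
  shows "(\<Sum>a<n. conj_mat n V X a a) = (\<Sum>a<n. X a a)"
proof -
  have "(\<Sum>a<n. conj_mat n V X a a) = (\<Sum>a<n. \<Sum>b<n. if a = b then conj_mat n V X a b else 0)"
    by simp
  also have "\<dots> = (\<Sum>a<n. \<Sum>b<n. conj_mat n V X a b * (if a = b then 1 else 0))"
    by (intro sum.cong refl) auto
  also have "\<dots> = (\<Sum>c<n. \<Sum>d<n. X c d * (\<Sum>a<n. \<Sum>b<n. V a c * V b d * (if a = b then 1 else 0)))"
    by (rule sum_conj[symmetric])
  also have "\<dots> = (\<Sum>c<n. \<Sum>d<n. X c d * (if c = d then 1 else 0))"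
    using assms by (intro sum.cong refl) (auto simp: orthonormal_def if_distrib[of "(*) _"] cong: if_cong)
  finally show ?thesis by (simp add: if_distrib[of "(*) _"] cong: if_cong)
qed

text \<open>The index contracted with \<open>X\<close> carries its factors of \<open>V\<close> over
  to \<open>X\<close>, producing \<open>conj_mat\<close>; in all remaining slots the factors cancel
  by orthogonality.\<close>

lemma tensor_form_act2:
  assumes V: "orthonormal n V"
  shows "tensor_form n k X (act2 n V T) (act2 n V T') = tensor_form n k (conj_mat n V X) T T'"
proof -
  have slot: "slot_form n X j l (act2 n V T) (act2 n V T') = slot_form n (conj_mat n V X) j l T T'" for j l
  proof -
    have "ip n j l (\<lambda>xs. act2 n V T (a # xs)) (\<lambda>xs. act2 n V T' (b # xs))
      = (\<Sum>c<n. \<Sum>d<n. V c a * V d b * ip n j l (\<lambda>xs. T (c # xs)) (\<lambda>xs. T' (d # xs)))" for a b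
    proof -
      have [abs_def]: "act2 n V T (a # xs) = (\<lambda>ys. \<Sum>c<n. V c a * act2 n V (\<lambda>xs. T (c # xs)) xs ys)"
        "act2 n V T' (b # xs) = (\<lambda>ys. \<Sum>d<n. V d b * act2 n V (\<lambda>xs. T' (d # xs)) xs ys)" for xs
        by (simp_all add: act2_Cons1 fun_eq_iff)
      thus ?thesis by (simp only: ip_sum2 ip_act2[OF V])
    qed
    thus ?thesis by (simp only: slot_form_def sum_conj)
  qed
  have cross: "cross_form n X j (act2 n V T) (act2 n V T') = cross_form n (conj_mat n V X) j T T'" for j
  proof -
    have "ip n j j (act2 n V T) (\<lambda>xs ys. act2 n V T' (a # xs) (b # ys))
      = (\<Sum>c<n. \<Sum>d<n. V c a * V d b * ip n j j T (\<lambda>xs ys. T' (c # xs) (d # ys)))" for a b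
    proof -
      have "(\<lambda>xs ys. act2 n V T' (a # xs) (b # ys))
        = (\<lambda>xs ys. \<Sum>c<n. V c a * (\<Sum>d<n. V d b * act2 n V (\<lambda>xs ys. T' (c # xs) (d # ys)) xs ys))"
        by (intro ext) (subst act2_Cons1, simp only: act2_Cons2)
      thus ?thesis by (simp only: ip_sum_right ip_act2[OF V]) (simp add: sum_distrib_left mult.assoc)
    qed
    thus ?thesis by (simp only: cross_form_def sum_conj)
  qed
  show ?thesis
    by (simp only: tensor_form_def slot cross trace_conj[OF V] ip_act2[OF V])
qed

lemma slot_form_sum2:
  "slot_form n X j l (\<lambda>xs ys. \<Sum>i\<in>I. c i * F i xs ys) (\<lambda>xs ys. \<Sum>i\<in>J. d i * G i xs ys)
    = (\<Sum>i\<in>I. \<Sum>k\<in>J. c i * d k * slot_form n X j l (F i) (G k))"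
proof -
  have "slot_form n X j l (\<lambda>xs ys. \<Sum>i\<in>I. c i * F i xs ys) (\<lambda>xs ys. \<Sum>i\<in>J. d i * G i xs ys)
    = (\<Sum>a<n. \<Sum>b<n. \<Sum>i\<in>I. \<Sum>k\<in>J. c i * d k * (X a b * ip n j l (\<lambda>xs. F i (a # xs)) (\<lambda>xs. G k (b # xs))))"
    by (simp add: slot_form_def ip_sum2 sum_distrib_left mult_ac)
  also have "\<dots> = (\<Sum>i\<in>I. \<Sum>k\<in>J. \<Sum>a<n. \<Sum>b<n. c i * d k * (X a b * ip n j l (\<lambda>xs. F i (a # xs)) (\<lambda>xs. G k (b # xs))))"
    by (rule sum4_rotate)
  finally show ?thesis by (simp add: slot_form_def sum_distrib_left)
qed

lemma cross_form_sum2: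
  "cross_form n X j (\<lambda>xs ys. \<Sum>i\<in>I. c i * F i xs ys) (\<lambda>xs ys. \<Sum>i\<in>J. d i * G i xs ys)
    = (\<Sum>i\<in>I. \<Sum>k\<in>J. c i * d k * cross_form n X j (F i) (G k))"
proof -
  have "cross_form n X j (\<lambda>xs ys. \<Sum>i\<in>I. c i * F i xs ys) (\<lambda>xs ys. \<Sum>i\<in>J. d i * G i xs ys)
    = (\<Sum>a<n. \<Sum>b<n. \<Sum>i\<in>I. \<Sum>k\<in>J. c i * d k * (X a b * ip n j j (F i) (\<lambda>xs ys. G k (a # xs) (b # ys))))"
    by (simp add: cross_form_def ip_sum2 sum_distrib_left mult_ac)
  also have "\<dots> = (\<Sum>i\<in>I. \<Sum>k\<in>J. \<Sum>a<n. \<Sum>b<n. c i * d k * (X a b * ip n j j (F i) (\<lambda>xs ys. G k (a # xs) (b # ys))))"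
    by (rule sum4_rotate)
  finally show ?thesis by (simp add: cross_form_def sum_distrib_left)
qed

lemma tensor_form_sum2:
  "tensor_form n k X (\<lambda>xs ys. \<Sum>i\<in>I. c i * F i xs ys) (\<lambda>xs ys. \<Sum>i\<in>J. d i * G i xs ys)
    = (\<Sum>i\<in>I. \<Sum>l\<in>J. c i * d l * tensor_form n k X (F i) (G l))"
proof -
  define g where "g j i l = (\<Sum>a<n. X a a) * ip n j j (F i) (G l) - real j * slot_form n X (j - 1) j (F i) (G l)
       - 2 * cross_form n X j (F i) (G l) + slot_form n X j (Suc j) (F i) (G l) / (real j + 1)" for j i l
  have "tensor_form n k X (\<lambda>xs ys. \<Sum>i\<in>I. c i * F i xs ys) (\<lambda>xs ys. \<Sum>i\<in>J. d i * G i xs ys)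
    = (\<Sum>j<k. level_weight k j * (\<Sum>i\<in>I. \<Sum>l\<in>J. c i * d l * g j i l))"
    by (simp add: tensor_form_def g_def slot_form_sum2 cross_form_sum2 ip_sum2 sum_distrib_left sum_divide_distrib
      sum_subtractf[symmetric] sum.distrib[symmetric] algebra_simps)
  also have "\<dots> = (\<Sum>j<k. \<Sum>i\<in>I. \<Sum>l\<in>J. c i * d l * (level_weight k j * g j i l))"
    by (simp add: sum_distrib_left mult_ac)
  also have "\<dots> = (\<Sum>i\<in>I. \<Sum>j<k. \<Sum>l\<in>J. c i * d l * (level_weight k j * g j i l))"
    by (rule sum.swap)
  also have "\<dots> = (\<Sum>i\<in>I. \<Sum>l\<in>J. \<Sum>j<k. c i * d l * (level_weight k j * g j i l))"
    by (rule sum.cong[OF refl], rule sum.swap)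
  finally show ?thesis by (simp add: tensor_form_def g_def sum_distrib_left)
qed

lemma ip_cong:
  assumes "\<And>xs ys. xs \<in> words n j \<Longrightarrow> ys \<in> words n l \<Longrightarrow> F xs ys = F' xs ys \<and> G xs ys = G' xs ys"
  shows "ip n j l F G = ip n j l F' G'"
  unfolding ip_def using assms by (intro sum.cong refl) auto

lemma Cons_words: "a < n \<Longrightarrow> xs \<in> words n j \<Longrightarrow> a # xs \<in> words n (Suc j)"
  by (auto simp: words_def)

text \<open>The form sees only finitely many entries of a tensor, those at words over {..<n} of
  length at most k. This is what later allows a matrix of finite size.\<close>

lemma tensor_form_cong:
  assumes "\<And>a b. a < n \<Longrightarrow> b < n \<Longrightarrow> X a b = X' a b"
    and "\<And>j l xs ys. j \<le> k \<Longrightarrow> l \<le> k \<Longrightarrow> xs \<in> words n j \<Longrightarrow> ys \<in> words n l \<Longrightarrow> F xs ys = F' xs ys \<and> G xs ys = G' xs ys"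
  shows "tensor_form n k X F G = tensor_form n k X' F' G'"
proof -
  have "slot_form n X j l F G = slot_form n X' j l F' G'" if "j < k" "l \<le> k" for j l
    unfolding slot_form_def
    by (intro sum.cong refl arg_cong2[of _ _ _ _ "(*)"] ip_cong assms(1) conjI
      assms(2)[of "Suc j" l, THEN conjunct1] assms(2)[of "Suc j" l, THEN conjunct2] Cons_words)
      (use that in auto)
  moreover have "cross_form n X j F G = cross_form n X' j F' G'" if "j < k" for j
    unfolding cross_form_def
    by (intro sum.cong refl arg_cong2[of _ _ _ _ "(*)"] ip_cong assms(1) conjI
      assms(2)[of j j, THEN conjunct1] assms(2)[of "Suc j" "Suc j", THEN conjunct2] Cons_words)
      (use that in auto)
  moreover have "ip n j j F G = ip n j j F' G'" if "j < k" for j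
    by (intro ip_cong assms(2)[of j j]) (use that in auto)
  moreover have "(\<Sum>a<n. X a a) = (\<Sum>a<n. X' a a)" by (intro sum.cong refl assms(1)) auto
  ultimately show ?thesis
    unfolding tensor_form_def by (intro sum.cong refl) auto
qed

lemma tensor_form_add_mat: "tensor_form n k (\<lambda>a b. X a b + Y a b) T T' = tensor_form n k X T T' + tensor_form n k Y T T'"
proof -
  let ?Z = "\<lambda>a b. X a b + Y a b"
  have slot: "slot_form n ?Z j l T T' = slot_form n X j l T T' + slot_form n Y j l T T'" for j l
    by (simp add: slot_form_def distrib_right sum.distrib)
  have cross: "cross_form n ?Z j T T' = cross_form n X j T T' + cross_form n Y j T T'" for j
    by (simp add: cross_form_def distrib_right sum.distrib)
  show ?thesis
    unfolding tensor_form_def slot cross sum.distrib[of _ _ "{..<k}", symmetric]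
    by (intro sum.cong refl) (simp add: sum.distrib add_divide_distrib algebra_simps)
qed

lemma tensor_form_scale_mat: "tensor_form n k (\<lambda>a b. c * X a b) T T' = c * tensor_form n k X T T'"
  by (simp add: tensor_form_def slot_form_def cross_form_def sum_distrib_left[symmetric] mult.assoc algebra_simps)
    (simp add: sum_distrib_left algebra_simps)

text \<open>Vanishing at row length k or more grounds the network: the highest level in the form
  would otherwise involve free tensors of level k.\<close>

definition alt_tensors :: "nat \<Rightarrow> tensor set" where
  "alt_tensors k = {T. (\<forall>ys. alternating (\<lambda>xs. T xs ys)) \<and> (\<forall>xs. alternating (T xs)) \<and>
     (\<forall>xs ys. k \<le> length xs \<longrightarrow> T xs ys = 0)}"

lemma act2_alt_tensors:
  assumes T: "T \<in> alt_tensors k"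
  shows "act2 n V T \<in> alt_tensors k"
proof -
  have "alternating (\<lambda>zs. act1 n V (T zs) ys)" for ys
  proof -
    have "act1 n V (T (swap_at i zs)) ys = - act1 n V (T zs) ys" if "Suc i < length zs" for i zs
    proof -
      have "T (swap_at i zs) = (\<lambda>ys. - T zs ys)"
        using T that by (auto simp: alt_tensors_def alternating_def)
      thus ?thesis by (simp add: act1_uminus)
    qed
    thus ?thesis by (simp add: alternating_def)
  qed
  hence "alternating (\<lambda>xs. act2 n V T xs ys)" for ys
    unfolding act2_def by (rule act1_alternating)
  moreover have "alternating (act2 n V T xs)" for xs
  proof -
    have "act2 n V T xs (swap_at i ys) = - act2 n V T xs ys" if "Suc i < length ys" for i ys
    proof -
      have "alternating (act1 n V (T zs))" for zs
        using T by (intro act1_alternating) (auto simp: alt_tensors_def)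
      hence "act1 n V (T zs) (swap_at i ys) = - act1 n V (T zs) ys" for zs
        using that by (simp add: alternating_def)
      thus ?thesis by (simp add: act2_def act1_uminus)
    qed
    thus ?thesis by (simp add: alternating_def)
  qed
  moreover have "act2 n V T xs ys = 0" if "k \<le> length xs" for xs ys
    unfolding act2_def using T that by (intro act1_eq_0) (auto simp: alt_tensors_def)
  ultimately show ?thesis by (simp add: alt_tensors_def)
qed

definition diag_fun :: "(nat \<Rightarrow> real) \<Rightarrow> nat \<Rightarrow> nat \<Rightarrow> real" where
  "diag_fun x = (\<lambda>a b. if a = b then x a else 0)"

lemma sum_diag: "a < n \<Longrightarrow> (\<Sum>b<n. diag_fun x a b * Z b) = x a * Z a"
  by (simp add: diag_fun_def if_distrib[of "\<lambda>y. y * _"] cong: if_cong)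

text \<open>The trace counts every letter, while j times the slot form counts the letters inside the
  row word, by \<open>alternating_sum_squares\<close>. The difference leaves the letters outside the
  word, which are the possible one-letter extensions of it.\<close>

lemma tensor_form_diag:
  assumes T: "T \<in> alt_tensors k"
  shows "tensor_form n k (diag_fun x) T T = (\<Sum>j<k. level_weight k j *
    ((\<Sum>xs\<in>words n j. \<Sum>ys\<in>words n j. \<Sum>u\<in>{..<n} - set xs. x u * (T xs ys)\<^sup>2 - 2 * x u * T xs ys * T (u # xs) (u # ys))
      + (\<Sum>u<n. x u * (\<Sum>xs\<in>words n j. \<Sum>ys\<in>words n (Suc j). (T (u # xs) ys)\<^sup>2)) / (real j + 1)))"
proof -
  have alt: "alternating (\<lambda>xs. T xs ys)" for ys using T by (simp add: alt_tensors_def)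
  have slot: "slot_form n (diag_fun x) j l T T = (\<Sum>u<n. x u * (\<Sum>xs\<in>words n j. \<Sum>ys\<in>words n l. (T (u # xs) ys)\<^sup>2))" for j l
    unfolding slot_form_def by (simp add: sum_diag) (simp add: ip_def power2_eq_square)
  have cross: "cross_form n (diag_fun x) j T T = (\<Sum>xs\<in>words n j. \<Sum>ys\<in>words n j. \<Sum>u\<in>{..<n} - set xs. x u * T xs ys * T (u # xs) (u # ys))" for j
  proof -
    have "cross_form n (diag_fun x) j T T = (\<Sum>u<n. \<Sum>xs\<in>words n j. \<Sum>ys\<in>words n j. x u * T xs ys * T (u # xs) (u # ys))"
      unfolding cross_form_def by (simp add: sum_diag) (simp add: ip_def sum_distrib_left mult.assoc)
    also have "\<dots> = (\<Sum>xs\<in>words n j. \<Sum>u<n. \<Sum>ys\<in>words n j. x u * T xs ys * T (u # xs) (u # ys))"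
      by (rule sum.swap)
    also have "\<dots> = (\<Sum>xs\<in>words n j. \<Sum>ys\<in>words n j. \<Sum>u<n. x u * T xs ys * T (u # xs) (u # ys))"
      by (rule sum.cong[OF refl], rule sum.swap)
    also have "\<dots> = (\<Sum>xs\<in>words n j. \<Sum>ys\<in>words n j. \<Sum>u\<in>{..<n} - set xs. x u * T xs ys * T (u # xs) (u # ys))"
      by (intro sum.cong refl sum.mono_neutral_right) (auto simp: alternating_eq_0[OF alt])
    finally show ?thesis .
  qed
  have lower: "(\<Sum>a<n. diag_fun x a a) * ip n j j T T - real j * slot_form n (diag_fun x) (j - 1) j T T
    = (\<Sum>xs\<in>words n j. \<Sum>ys\<in>words n j. \<Sum>u\<in>{..<n} - set xs. x u * (T xs ys)\<^sup>2)" for j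
  proof -
    have "real j * slot_form n (diag_fun x) (j - 1) j T T = (\<Sum>xs\<in>words n j. \<Sum>ys\<in>words n j. \<Sum>u\<in>set xs. x u * (T xs ys)\<^sup>2)"
    proof (cases j)
      case (Suc i)
      have "slot_form n (diag_fun x) i j T T = (\<Sum>u<n. \<Sum>ys\<in>words n j. x u * (\<Sum>xs\<in>words n i. (T (u # xs) ys)\<^sup>2))"
        unfolding slot sum_distrib_left[symmetric] by (intro sum.cong refl arg_cong2[of _ _ _ _ "(*)"] sum.swap)
      also have "\<dots> = (\<Sum>ys\<in>words n j. \<Sum>u<n. x u * (\<Sum>xs\<in>words n i. (T (u # xs) ys)\<^sup>2))"
        by (rule sum.swap)
      finally have "real j * slot_form n (diag_fun x) i j T T = (\<Sum>ys\<in>words n j. \<Sum>xs\<in>words n j. (\<Sum>u\<in>set xs. x u) * (T xs ys)\<^sup>2)"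
        unfolding Suc alternating_sum_squares[OF alt] by (simp add: sum_distrib_left)
      also have "\<dots> = (\<Sum>xs\<in>words n j. \<Sum>ys\<in>words n j. (\<Sum>u\<in>set xs. x u) * (T xs ys)\<^sup>2)"
        by (rule sum.swap)
      finally show ?thesis by (simp add: Suc sum_distrib_right)
    qed simp
    moreover have "(\<Sum>a<n. diag_fun x a a) * ip n j j T T = (\<Sum>xs\<in>words n j. \<Sum>ys\<in>words n j. \<Sum>u<n. x u * (T xs ys)\<^sup>2)"
      by (simp add: diag_fun_def ip_def sum_distrib_left sum_distrib_right power2_eq_square)
    moreover have "(\<Sum>u<n. x u * (T xs ys)\<^sup>2) - (\<Sum>u\<in>set xs. x u * (T xs ys)\<^sup>2) = (\<Sum>u\<in>{..<n} - set xs. x u * (T xs ys)\<^sup>2)"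
      if "xs \<in> words n j" for xs ys
      using that by (subst sum_diff) (auto simp: words_def)
    ultimately show ?thesis by (simp add: sum_subtractf[symmetric])
  qed
  show ?thesis
    unfolding tensor_form_def lower unfolding slot cross
    by (simp add: sum_subtractf[symmetric] sum_distrib_left mult_ac)
qed

section \<open>Positivity on the cone\<close>

text \<open>A letter of a word without repetitions can sit in any of j + 1 positions, all
  contributing equally. The inequality throws away the words that do not contain u; applied to
  column words, it disposes of the entries of a tensor that have no counterpart in the
  network.\<close>

lemma alternating_sum_ge:
  assumes F: "alternating F" and u: "u < n"
  shows "real (Suc j) * (\<Sum>ys\<in>words n j. (F (u # ys))\<^sup>2) \<le> (\<Sum>ys\<in>words n (Suc j). (F ys)\<^sup>2)"
proof -
  let ?x = "\<lambda>v. if v = u then 1 else 0 :: real"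
  have "real (Suc j) * (\<Sum>ys\<in>words n j. (F (u # ys))\<^sup>2) = real (Suc j) * (\<Sum>a<n. ?x a * (\<Sum>ys\<in>words n j. (F (a # ys))\<^sup>2))"
    using u by (simp add: if_distrib[of "\<lambda>y. y * _"] cong: if_cong)
  also have "\<dots> = (\<Sum>ys\<in>words n (Suc j). (\<Sum>v\<in>set ys. ?x v) * (F ys)\<^sup>2)"
    by (rule alternating_sum_squares[OF F, symmetric])
  also have "\<dots> \<le> (\<Sum>ys\<in>words n (Suc j). (F ys)\<^sup>2)"
    by (intro sum_mono) (simp add: sum.delta mult_left_le_one_le)
  finally show ?thesis .
qed

text \<open>With h_j = (k - j)! / j! times g_j, the weight turns the two terms of the summand into
  h_j and h_(j+1). This is the origin of \<open>level_weight\<close>.\<close>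

lemma sum_fact_telescope:
  fixes g :: "nat \<Rightarrow> real"
  shows "(\<Sum>j<k. level_weight k j * (real (k - j) * g j - g (Suc j) / (real j + 1))) = fact k * g 0 - g k / fact k"
proof -
  define h where "h j = fact (k - j) / fact j * g j" for j
  have "level_weight k j * (real (k - j) * g j - g (Suc j) / (real j + 1)) = h j - h (Suc j)" if "j < k" for j
  proof -
    have "(fact (k - j) :: real) = real (k - j) * fact (k - Suc j)"
      using that by (subst fact_reduce) auto
    hence "level_weight k j * real (k - j) = fact (k - j) / fact j" by (simp add: level_weight_def)
    moreover have "level_weight k j / (real j + 1) = fact (k - Suc j) / fact (Suc j)"
      by (simp add: level_weight_def add.commute)
    moreover have "level_weight k j * (real (k - j) * g j - g (Suc j) / (real j + 1))
      = level_weight k j * real (k - j) * g j - level_weight k j / (real j + 1) * g (Suc j)"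
      by (simp add: right_diff_distrib)
    ultimately show ?thesis by (simp add: h_def)
  qed
  hence "(\<Sum>j<k. level_weight k j * (real (k - j) * g j - g (Suc j) / (real j + 1))) = (\<Sum>j<k. h j - h (Suc j))"
    by (intro sum.cong) auto
  also have "\<dots> = h 0 - h k" by (rule sum_lessThan_telescope')
  finally show ?thesis by (simp add: h_def)
qed

text \<open>Put q = c / b', so that b / b' = y + q and y c / b is the conductance of y and q in
  series. It is the minimum over T of y (D - T)^2 + q T^2, attained at T = y b' D / b. Only y + q
  has to be positive, so y may be negative.\<close>

lemma complete_square_ge:
  fixes y b b' c D T :: real
  assumes "b > 0" "b' > 0" "b = y * b' + c"
  shows "y * c / b * D\<^sup>2 \<le> y * D\<^sup>2 - 2 * y * D * T + b / b' * T\<^sup>2"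
proof -
  have "y * D\<^sup>2 - 2 * y * D * T + b / b' * T\<^sup>2 - y * c / b * D\<^sup>2 = (y * b' * D - b * T)\<^sup>2 / (b * b')"
    using assms(1,2) unfolding assms(3) by (simp add: field_simps power2_eq_square)
  also have "\<dots> \<ge> 0" using assms by simp
  finally show ?thesis by simp
qed

text \<open>\<open>Q j\<close> weights the squared entries of level j by the ratios that the
  recursion assigns to their row words. Each level of the form dominates (k - j) Q_j - Q_(j+1) / (j
  + 1), and with the weights these bounds add up to k! Q_0 - Q_k / k!.\<close>

lemma tensor_form_diag_nonneg:
  assumes n: "d + k = n" and T: "T \<in> alt_tensors k"
    and pos: "\<And>t. t \<ge> s \<Longrightarrow> poly (dpoly x d {..<n}) t > 0"
  shows "tensor_form n k (diag_fun (\<lambda>i. x i + s)) T T \<ge> 0"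
proof -
  define y where "y i = x i + s" for i
  define \<alpha> where "\<alpha> S = poly (dpoly x d S) s" for S
  define \<beta> where "\<beta> S = poly (dpoly x (Suc d) S) s" for S
  define R where "R xs = {..<n} - set xs" for xs
  \<comment> \<open>The ratio of elementary symmetric polynomials of degrees \<open>k - j\<close> and \<open>k - j - 1\<close> in the variables
    outside the word \<open>xs\<close> of length \<open>j\<close>.\<close>
  define q where "q xs = (real d + 1) * \<alpha> (R xs) / \<beta> (R xs)" for xs
  define Q where "Q j = (\<Sum>xs\<in>words n j. \<Sum>ys\<in>words n j. q xs * (T xs ys)\<^sup>2)" for j
  have finR [simp]: "finite (R xs)" for xs by (simp add: R_def)
  have R_Cons: "R (u # xs) = R xs - {u}" for u xs by (auto simp: R_def)
  have \<beta>_pos: "\<beta> (R xs) > 0" if "xs \<in> words n j" "j < k" for xs j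
    unfolding \<beta>_def R_def
  proof (rule dpoly_Suc_diff_pos[OF _ _ _ _ pos order_refl])
    have "card (set xs) \<le> j" using that card_length[of xs] by (simp add: words_def)
    thus "d + card (set xs) < card {..<n}" using that n by simp
  qed (use that in \<open>auto simp: words_def\<close>)
  have \<beta>_rec: "\<beta> S = y u * \<beta> (S - {u}) + (real d + 1) * \<alpha> (S - {u})" if "finite S" "u \<in> S" for S u
    unfolding \<beta>_def \<alpha>_def y_def by (rule poly_dpoly_Suc[OF that])
  have T0: "T xs ys = 0" if "\<not> distinct xs \<or> k \<le> length xs" for xs ys
  proof (cases "distinct xs")
    case False
    thus ?thesis using T alternating_eq_0[of "\<lambda>xs. T xs ys" xs] by (simp add: alt_tensors_def)
  qed (use that T in \<open>auto simp: alt_tensors_def\<close>)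
  have alt: "alternating (T xs)" for xs using T by (simp add: alt_tensors_def)
  define B where "B j = (\<Sum>xs\<in>words n j. \<Sum>ys\<in>words n j. \<Sum>u\<in>R xs. y u * (T xs ys)\<^sup>2 - 2 * y u * T xs ys * T (u # xs) (u # ys))
      + (\<Sum>u<n. y u * (\<Sum>xs\<in>words n j. \<Sum>ys\<in>words n (Suc j). (T (u # xs) ys)\<^sup>2)) / (real j + 1)" for j
  have step: "real (k - j) * Q j - Q (Suc j) / (real j + 1) \<le> B j" if j: "j < k" for j
  proof -
    \<comment> \<open>This is the coefficient b / b' of \<open>complete_square_ge\<close>. At the
      last level, k = j + 1, the denominator b' is zero, so the quotient formula is restricted to
      \<open>Suc j < k\<close>.\<close>
    define \<phi> where "\<phi> u xs = y u + q (u # xs)" for u xs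
    have \<phi>_eq: "\<phi> u xs = \<beta> (R xs) / \<beta> (R xs - {u})" if "u \<in> R xs" "xs \<in> words n j" "Suc j < k" for u xs
    proof -
      have "u # xs \<in> words n (Suc j)" using that by (intro Cons_words) (auto simp: R_def)
      from \<beta>_pos[OF this that(3)] show ?thesis
        using \<beta>_rec[OF finR that(1)] by (simp add: \<phi>_def q_def R_Cons field_simps)
    qed
    have Q_Suc: "Q (Suc j) = (\<Sum>u<n. \<Sum>xs\<in>words n j. \<Sum>ys\<in>words n (Suc j). q (u # xs) * (T (u # xs) ys)\<^sup>2)"
      unfolding Q_def by (rule sum_words_Suc)
    \<comment> \<open>The estimate of \<open>alternating_sum_ge\<close> cannot be multiplied by y_u,
      which may be negative. Adding \<open>Q (Suc j)\<close> first replaces y_u by \<phi>, which is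
      nonnegative wherever the tensor does not vanish.\<close>
    have "(\<Sum>u<n. y u * (\<Sum>xs\<in>words n j. \<Sum>ys\<in>words n (Suc j). (T (u # xs) ys)\<^sup>2)) + Q (Suc j)
      = (\<Sum>u<n. \<Sum>xs\<in>words n j. \<phi> u xs * (\<Sum>ys\<in>words n (Suc j). (T (u # xs) ys)\<^sup>2))"
      by (simp add: Q_Suc \<phi>_def sum_distrib_left distrib_right sum.distrib)
    also have "\<dots> \<ge> (\<Sum>u<n. \<Sum>xs\<in>words n j. \<phi> u xs * ((real j + 1) * (\<Sum>ys\<in>words n j. (T (u # xs) (u # ys))\<^sup>2)))"
    proof (intro sum_mono)
      fix u xs assume u: "u \<in> {..<n}" and xs: "xs \<in> words n j"
      show "\<phi> u xs * ((real j + 1) * (\<Sum>ys\<in>words n j. (T (u # xs) (u # ys))\<^sup>2)) \<le> \<phi> u xs * (\<Sum>ys\<in>words n (Suc j). (T (u # xs) ys)\<^sup>2)"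
      proof (cases "distinct (u # xs) \<and> Suc j < k")
        case True
        have uR: "u \<in> R xs" using True u by (simp add: R_def)
        have "u # xs \<in> words n (Suc j)" using u xs by (intro Cons_words) auto
        hence "\<phi> u xs \<ge> 0" using \<phi>_eq[OF uR xs] \<beta>_pos[OF xs j] \<beta>_pos[of "u # xs" "Suc j"] True
          by (simp add: R_Cons)
        thus ?thesis using alternating_sum_ge[OF alt, of u n j "u # xs"] u
          by (intro mult_left_mono) (auto simp: add.commute)
      next
        case False
        hence "T (u # xs) ys = 0" for ys using xs by (intro T0) (auto simp: words_def)
        thus ?thesis by simp
      qed
    qed
    also have "(\<Sum>u<n. \<Sum>xs\<in>words n j. \<phi> u xs * ((real j + 1) * (\<Sum>ys\<in>words n j. (T (u # xs) (u # ys))\<^sup>2)))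
      = (real j + 1) * (\<Sum>u<n. \<Sum>xs\<in>words n j. \<Sum>ys\<in>words n j. \<phi> u xs * (T (u # xs) (u # ys))\<^sup>2)"
      by (simp add: sum_distrib_left mult_ac)
    also have "(\<Sum>u<n. \<Sum>xs\<in>words n j. \<Sum>ys\<in>words n j. \<phi> u xs * (T (u # xs) (u # ys))\<^sup>2)
      = (\<Sum>xs\<in>words n j. \<Sum>u<n. \<Sum>ys\<in>words n j. \<phi> u xs * (T (u # xs) (u # ys))\<^sup>2)"
      by (rule sum.swap)
    also have "\<dots> = (\<Sum>xs\<in>words n j. \<Sum>ys\<in>words n j. \<Sum>u<n. \<phi> u xs * (T (u # xs) (u # ys))\<^sup>2)"
      by (rule sum.cong[OF refl], rule sum.swap)
    also have "\<dots> = (\<Sum>xs\<in>words n j. \<Sum>ys\<in>words n j. \<Sum>u\<in>R xs. \<phi> u xs * (T (u # xs) (u # ys))\<^sup>2)"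
      by (intro sum.cong refl sum.mono_neutral_right) (auto simp: R_def T0)
    finally have "(\<Sum>xs\<in>words n j. \<Sum>ys\<in>words n j. \<Sum>u\<in>R xs. \<phi> u xs * (T (u # xs) (u # ys))\<^sup>2)
      \<le> ((\<Sum>u<n. y u * (\<Sum>xs\<in>words n j. \<Sum>ys\<in>words n (Suc j). (T (u # xs) ys)\<^sup>2)) + Q (Suc j)) / (real j + 1)"
      by (simp add: field_simps)
    hence "(\<Sum>xs\<in>words n j. \<Sum>ys\<in>words n j. \<Sum>u\<in>R xs.
        y u * (T xs ys)\<^sup>2 - 2 * y u * T xs ys * T (u # xs) (u # ys) + \<phi> u xs * (T (u # xs) (u # ys))\<^sup>2)
      \<le> B j + Q (Suc j) / (real j + 1)"
      by (simp add: B_def sum.distrib add_divide_distrib)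
    moreover have "real (k - j) * Q j \<le> (\<Sum>xs\<in>words n j. \<Sum>ys\<in>words n j. \<Sum>u\<in>R xs.
        y u * (T xs ys)\<^sup>2 - 2 * y u * T xs ys * T (u # xs) (u # ys) + \<phi> u xs * (T (u # xs) (u # ys))\<^sup>2)"
      unfolding Q_def sum_distrib_left
    proof (intro sum_mono)
      fix xs ys assume xs: "xs \<in> words n j" and ys: "ys \<in> words n j"
      show "real (k - j) * (q xs * (T xs ys)\<^sup>2) \<le> (\<Sum>u\<in>R xs.
        y u * (T xs ys)\<^sup>2 - 2 * y u * T xs ys * T (u # xs) (u # ys) + \<phi> u xs * (T (u # xs) (u # ys))\<^sup>2)"
      proof (cases "distinct xs")
        case False
        thus ?thesis by (simp add: T0)
      next
        case True
        have card: "card (R xs) = n - j"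
          using xs True by (simp add: R_def card_Diff_subset words_def distinct_card)
        have "real (k - j) * (q xs * (T xs ys)\<^sup>2)
          = (real d + 1) * (\<Sum>u\<in>R xs. y u * \<alpha> (R xs - {u})) / \<beta> (R xs) * (T xs ys)\<^sup>2"
          using dpoly_Euler[of "R xs" x s d] card n j by (simp add: q_def \<alpha>_def y_def of_nat_diff)
        also have "\<dots> = (\<Sum>u\<in>R xs. y u * ((real d + 1) * \<alpha> (R xs - {u})) / \<beta> (R xs) * (T xs ys)\<^sup>2)"
          by (simp add: sum_distrib_left sum_divide_distrib sum_distrib_right mult_ac)
        also have "\<dots> \<le> (\<Sum>u\<in>R xs.
          y u * (T xs ys)\<^sup>2 - 2 * y u * T xs ys * T (u # xs) (u # ys) + \<phi> u xs * (T (u # xs) (u # ys))\<^sup>2)"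
        proof (rule sum_mono)
          fix u assume u: "u \<in> R xs"
          have uxs: "u # xs \<in> words n (Suc j)" using u xs by (intro Cons_words) (auto simp: R_def)
          show "y u * ((real d + 1) * \<alpha> (R xs - {u})) / \<beta> (R xs) * (T xs ys)\<^sup>2
            \<le> y u * (T xs ys)\<^sup>2 - 2 * y u * T xs ys * T (u # xs) (u # ys) + \<phi> u xs * (T (u # xs) (u # ys))\<^sup>2"
          proof (cases "Suc j < k")
            case True
            thus ?thesis unfolding \<phi>_eq[OF u xs True]
              using \<beta>_pos[OF xs j] \<beta>_pos[OF uxs True] \<beta>_rec[OF finR u]
              by (intro complete_square_ge) (auto simp: R_Cons)
          next
            case False
            \<comment> \<open>At the last level the extended tensor entry is zero. Without u there
              are only d variables left, so their derivative of order d + 1 vanishes and the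
              recursion makes both sides equal to y_u times the squared entry.\<close>
            hence k: "k = Suc j" using j by simp
            have "card (R xs - {u}) = d" using card u n k by simp
            hence "\<beta> (R xs - {u}) = 0" unfolding \<beta>_def by (subst dpoly_eq_0) auto
            hence "(real d + 1) * \<alpha> (R xs - {u}) = \<beta> (R xs)"
              using \<beta>_rec[OF finR u] by simp
            hence "y u * ((real d + 1) * \<alpha> (R xs - {u})) / \<beta> (R xs) = y u"
              using \<beta>_pos[OF xs j] by (simp only:) simp
            moreover have "T (u # xs) (u # ys) = 0" using xs k by (intro T0) (auto simp: words_def)
            ultimately show ?thesis by simp
          qed
        qed
        finally show ?thesis .
      qed
    qed
    ultimately show ?thesis by linarith
  qed
  have "Q k = 0" unfolding Q_def by (intro sum.neutral ballI) (auto simp: words_def T0)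
  moreover have "Q 0 \<ge> 0"
  proof (cases k)
    case 0
    thus ?thesis using \<open>Q k = 0\<close> by simp
  next
    case (Suc k')
    have "\<alpha> {..<n} > 0" unfolding \<alpha>_def by (rule pos) simp
    thus ?thesis using \<beta>_pos[of "[]" 0] Suc by (simp add: Q_def q_def R_def)
  qed
  ultimately have "0 \<le> fact k * Q 0 - Q k / fact k" by simp
  also have "\<dots> = (\<Sum>j<k. level_weight k j * (real (k - j) * Q j - Q (Suc j) / (real j + 1)))"
    by (rule sum_fact_telescope[symmetric])
  also have "\<dots> \<le> (\<Sum>j<k. level_weight k j * B j)"
    by (intro sum_mono mult_left_mono step) (auto simp: level_weight_def)
  also have "\<dots> = tensor_form n k (diag_fun y) T T"
    unfolding tensor_form_diag[OF T] B_def R_def ..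
  finally show ?thesis by (simp add: y_def[abs_def])
qed

section \<open>Failure of positivity outside the cone\<close>

text \<open>The sign of the sorting permutation, as a product over pairs of positions;
  \<open>sgn 0 = 0\<close> makes it vanish on words with repeated letters.\<close>

fun word_sign :: "nat list \<Rightarrow> real" where
  "word_sign [] = 1"
| "word_sign (a # xs) = prod_list (map (\<lambda>b. sgn (real b - real a)) xs) * word_sign xs"

lemma prod_list_map_cong_mset: "mset xs = mset ys \<Longrightarrow> prod_list (map f xs) = (prod_list (map f ys) :: 'a :: comm_monoid_mult)"
  by (metis mset_map prod_mset_prod_list)

lemma alternating_word_sign: "alternating word_sign"
proof -
  have "word_sign (swap_at i xs) = - word_sign xs" if "Suc i < length xs" for i xs
    using that
  proof (induction xs arbitrary: i)
    case (Cons a xs)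
    show ?case
    proof (cases i)
      case (Suc i')
      thus ?thesis using Cons prod_list_map_cong_mset[OF mset_swap_at, of i' xs "\<lambda>b. sgn (real b - real a)"] by simp
    next
      case 0
      then obtain b ys where xs: "xs = b # ys" using Cons.prems by (cases xs) auto
      have "sgn (real a - real b) = - sgn (real b - real a)"
        by (simp add: sgn_if)
      thus ?thesis by (simp add: 0 xs)
    qed
  qed simp
  thus ?thesis by (simp add: alternating_def)
qed

lemma prod_list_sgn_sq: "u \<notin> set xs \<Longrightarrow> (prod_list (map (\<lambda>b. sgn (real b - real u)) xs))\<^sup>2 = 1"
  by (induction xs) (auto simp: power_mult_distrib sgn_if)

lemma word_sign_sq: "distinct xs \<Longrightarrow> (word_sign xs)\<^sup>2 = 1"
  by (induction xs) (auto simp: power_mult_distrib prod_list_sgn_sq)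

text \<open>Prefixing u multiplies the sign by a factor that depends only on the set of the other
  letters. The factor occurs twice and squares to 1, so no signs survive in the cross terms.\<close>

lemma word_sign_Cons_mult:
  assumes "distinct xs" "distinct ys" "set xs = set ys" "u \<notin> set xs"
  shows "word_sign (u # xs) * word_sign (u # ys) = word_sign xs * word_sign ys"
proof -
  have "mset xs = mset ys" using assms by (simp add: set_eq_iff_mset_eq_distinct)
  hence "prod_list (map (\<lambda>b. sgn (real b - real u)) xs) = prod_list (map (\<lambda>b. sgn (real b - real u)) ys)"
    by (rule prod_list_map_cong_mset)
  thus ?thesis using prod_list_sgn_sq[OF assms(4)] by (simp add: power2_eq_square algebra_simps)
qed

text \<open>The antisymmetrisation of the diagonal tensor with entries \<open>f S\<close>.\<close>

definition diag_tensor :: "(nat set \<Rightarrow> real) \<Rightarrow> tensor" where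
  "diag_tensor f xs ys = (if set xs = set ys then word_sign xs * word_sign ys * f (set xs) else 0)"

lemma diag_tensor_alt_tensors:
  assumes "\<And>S. finite S \<Longrightarrow> k \<le> card S \<Longrightarrow> f S = 0"
  shows "diag_tensor f \<in> alt_tensors k"
proof -
  have "diag_tensor f xs ys = 0" if "k \<le> length xs" for xs ys
  proof (cases "distinct xs")
    case True
    hence "f (set xs) = 0" using assms[of "set xs"] that by (simp add: distinct_card)
    thus ?thesis unfolding diag_tensor_def by (simp only: mult_zero_right if_cancel)
  qed (simp add: diag_tensor_def alternating_eq_0[OF alternating_word_sign])
  moreover have "word_sign (swap_at i xs) = - word_sign xs" if "Suc i < length xs" for i xs
    using alternating_word_sign that by (simp add: alternating_def)
  ultimately show ?thesis
    by (auto simp: alt_tensors_def alternating_def diag_tensor_def set_swap_at)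
qed

lemma sum_words_same_set:
  assumes "xs \<in> words n j" "distinct xs"
  shows "(\<Sum>ys\<in>words n j. if distinct ys \<and> set ys = set xs then c else 0) = fact j * (c :: real)"
proof -
  have "{ys \<in> words n j. distinct ys \<and> set ys = set xs} = permutations_of_set (set xs)"
    using assms by (auto simp: words_def permutations_of_set_def distinct_card[symmetric])
  hence "card {ys \<in> words n j. distinct ys \<and> set ys = set xs} = fact j"
    using assms by (simp add: words_def distinct_card)
  thus ?thesis by (simp add: sum.If_cases Int_def)
qed

definition dwords :: "nat \<Rightarrow> nat \<Rightarrow> nat list set" where
  "dwords n j = {xs \<in> words n j. distinct xs}"

lemma finite_dwords [simp]: "finite (dwords n j)" by (simp add: dwords_def)

lemma sum_dwords_Suc:
  "(\<Sum>xs\<in>dwords n (Suc j). F xs) = (\<Sum>xs\<in>dwords n j. \<Sum>u\<in>{..<n} - set xs. F (u # xs))"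
proof -
  have if_eq: "(\<Sum>xs\<in>dwords n i. G xs) = (\<Sum>xs\<in>words n i. if distinct xs then G xs else 0)" for i and G :: "nat list \<Rightarrow> 'a"
    unfolding dwords_def by (intro sum.mono_neutral_cong_left) auto
  have "(\<Sum>xs\<in>dwords n (Suc j). F xs) = (\<Sum>xs\<in>words n j. \<Sum>u<n. if distinct (u # xs) then F (u # xs) else 0)"
    unfolding if_eq sum_words_Suc by (rule sum.swap)
  also have "\<dots> = (\<Sum>xs\<in>words n j. if distinct xs then (\<Sum>u\<in>{..<n} - set xs. F (u # xs)) else 0)"
    by (intro sum.cong refl) (auto intro!: sum.mono_neutral_cong_right)
  finally show ?thesis unfolding if_eq .
qed

lemma sum_if_const_cond: "(\<Sum>u\<in>A. if P then g u else 0) = (if P then \<Sum>u\<in>A. g u else 0)"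
  by simp

text \<open>On these tensors the form is the energy of a network on subsets, with an edge of
  conductance x_u from S to S with u added. Summing over the column orderings gives j! at level j
  and (j + 1)! / (j + 1) = j! at level j + 1; both cancel the j! in \<open>level_weight\<close>, and
  the terms merge into a square.\<close>

lemma tensor_form_diag_tensor:
  assumes f: "\<And>S. finite S \<Longrightarrow> k \<le> card S \<Longrightarrow> f S = 0"
  shows "tensor_form n k (diag_fun x) (diag_tensor f) (diag_tensor f) = (\<Sum>j<k. fact (k - Suc j) *
    (\<Sum>xs\<in>dwords n j. \<Sum>u\<in>{..<n} - set xs. x u * (f (set xs) - f (insert u (set xs)))\<^sup>2))"
proof -
  let ?T = "diag_tensor f"
  have sq: "(?T xs ys)\<^sup>2 = (if distinct ys \<and> set ys = set xs then (f (set xs))\<^sup>2 else 0)" if "distinct xs" for xs ys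
    using that alternating_eq_0[OF alternating_word_sign, of ys]
    by (auto simp: diag_tensor_def power_mult_distrib word_sign_sq)
  have nd: "?T xs ys = 0" if "\<not> distinct xs" for xs ys
    using that by (simp add: diag_tensor_def alternating_eq_0[OF alternating_word_sign])
  have cr: "?T xs ys * ?T (u # xs) (u # ys) = (if distinct ys \<and> set ys = set xs then f (set xs) * f (insert u (set xs)) else 0)"
    if "distinct xs" "u \<notin> set xs" for xs ys u
  proof (cases "distinct ys \<and> set ys = set xs")
    case True
    have "?T xs ys * ?T (u # xs) (u # ys) = word_sign xs * word_sign ys * (word_sign (u # xs) * word_sign (u # ys)) * (f (set xs) * f (insert u (set xs)))"
      using True by (simp add: diag_tensor_def del: word_sign.simps)
    also have "\<dots> = (word_sign xs)\<^sup>2 * (word_sign ys)\<^sup>2 * (f (set xs) * f (insert u (set xs)))"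
      using word_sign_Cons_mult[of xs ys u] True that by (simp add: power2_eq_square mult_ac del: word_sign.simps)
    finally show ?thesis using True that by (simp add: word_sign_sq)
  next
    case False
    hence "?T xs ys = 0" using sq[OF that(1), of ys] by (simp only: if_False) simp
    thus ?thesis using False by (simp only: if_False mult_zero_left)
  qed
  have first: "(\<Sum>xs\<in>words n j. \<Sum>ys\<in>words n j. \<Sum>u\<in>{..<n} - set xs. x u * (?T xs ys)\<^sup>2 - 2 * x u * ?T xs ys * ?T (u # xs) (u # ys))
    = fact j * (\<Sum>xs\<in>dwords n j. \<Sum>u\<in>{..<n} - set xs. x u * (f (set xs))\<^sup>2 - 2 * x u * (f (set xs) * f (insert u (set xs))))" for j
  proof -
    have "(\<Sum>xs\<in>words n j. \<Sum>ys\<in>words n j. \<Sum>u\<in>{..<n} - set xs. x u * (?T xs ys)\<^sup>2 - 2 * x u * ?T xs ys * ?T (u # xs) (u # ys))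
      = (\<Sum>xs\<in>dwords n j. \<Sum>ys\<in>words n j. \<Sum>u\<in>{..<n} - set xs. x u * (?T xs ys)\<^sup>2 - 2 * x u * ?T xs ys * ?T (u # xs) (u # ys))"
      unfolding dwords_def by (intro sum.mono_neutral_right) (auto simp: nd)
    also have "\<dots> = (\<Sum>xs\<in>dwords n j. \<Sum>ys\<in>words n j. if distinct ys \<and> set ys = set xs
        then (\<Sum>u\<in>{..<n} - set xs. x u * (f (set xs))\<^sup>2 - 2 * x u * (f (set xs) * f (insert u (set xs)))) else 0)"
    proof (intro sum.cong refl)
      fix xs ys assume "xs \<in> dwords n j"
      hence d: "distinct xs" by (simp add: dwords_def)
      have "(\<Sum>u\<in>{..<n} - set xs. x u * (?T xs ys)\<^sup>2 - 2 * x u * ?T xs ys * ?T (u # xs) (u # ys))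
        = (\<Sum>u\<in>{..<n} - set xs. if distinct ys \<and> set ys = set xs then x u * (f (set xs))\<^sup>2 - 2 * x u * (f (set xs) * f (insert u (set xs))) else 0)"
        by (intro sum.cong refl) (use cr[OF d] sq[OF d] in \<open>simp add: mult.assoc\<close>)
      also have "\<dots> = (if distinct ys \<and> set ys = set xs
        then (\<Sum>u\<in>{..<n} - set xs. x u * (f (set xs))\<^sup>2 - 2 * x u * (f (set xs) * f (insert u (set xs)))) else 0)"
        by (rule sum_if_const_cond)
      finally show "(\<Sum>u\<in>{..<n} - set xs. x u * (?T xs ys)\<^sup>2 - 2 * x u * ?T xs ys * ?T (u # xs) (u # ys))
        = (if distinct ys \<and> set ys = set xs
        then (\<Sum>u\<in>{..<n} - set xs. x u * (f (set xs))\<^sup>2 - 2 * x u * (f (set xs) * f (insert u (set xs)))) else 0)"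
        .
    qed
    also have "\<dots> = (\<Sum>xs\<in>dwords n j. fact j *
        (\<Sum>u\<in>{..<n} - set xs. x u * (f (set xs))\<^sup>2 - 2 * x u * (f (set xs) * f (insert u (set xs)))))"
      by (intro sum.cong refl sum_words_same_set) (auto simp: dwords_def)
    finally show ?thesis by (simp add: sum_distrib_left)
  qed
  have second: "(\<Sum>u<n. x u * (\<Sum>xs\<in>words n j. \<Sum>ys\<in>words n (Suc j). (?T (u # xs) ys)\<^sup>2)) / (real j + 1)
    = fact j * (\<Sum>xs\<in>dwords n j. \<Sum>u\<in>{..<n} - set xs. x u * (f (insert u (set xs)))\<^sup>2)" for j
  proof -
    have "(\<Sum>u<n. x u * (\<Sum>xs\<in>words n j. \<Sum>ys\<in>words n (Suc j). (?T (u # xs) ys)\<^sup>2))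
      = (\<Sum>w\<in>words n (Suc j). \<Sum>ys\<in>words n (Suc j). x (hd w) * (?T w ys)\<^sup>2)"
      by (simp add: sum_words_Suc[of "\<lambda>w. \<Sum>ys\<in>words n (Suc j). x (hd w) * (?T w ys)\<^sup>2"] sum_distrib_left)
    also have "\<dots> = (\<Sum>w\<in>dwords n (Suc j). \<Sum>ys\<in>words n (Suc j). x (hd w) * (?T w ys)\<^sup>2)"
      unfolding dwords_def by (intro sum.mono_neutral_right) (auto simp: nd)
    also have "\<dots> = (\<Sum>w\<in>dwords n (Suc j). \<Sum>ys\<in>words n (Suc j). if distinct ys \<and> set ys = set w then x (hd w) * (f (set w))\<^sup>2 else 0)"
      by (intro sum.cong refl) (auto simp: sq dwords_def)
    also have "\<dots> = (\<Sum>w\<in>dwords n (Suc j). fact (Suc j) * (x (hd w) * (f (set w))\<^sup>2))"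
      by (intro sum.cong refl sum_words_same_set) (auto simp: dwords_def)
    also have "\<dots> = fact (Suc j) * (\<Sum>xs\<in>dwords n j. \<Sum>u\<in>{..<n} - set xs. x u * (f (insert u (set xs)))\<^sup>2)"
      by (simp add: sum_dwords_Suc sum_distrib_left)
    finally show ?thesis by (simp add: field_simps)
  qed
  have square: "(\<Sum>xs\<in>dwords n j. \<Sum>u\<in>{..<n} - set xs. x u * (f (set xs))\<^sup>2 - 2 * x u * (f (set xs) * f (insert u (set xs))))
      + (\<Sum>xs\<in>dwords n j. \<Sum>u\<in>{..<n} - set xs. x u * (f (insert u (set xs)))\<^sup>2)
    = (\<Sum>xs\<in>dwords n j. \<Sum>u\<in>{..<n} - set xs. x u * (f (set xs) - f (insert u (set xs)))\<^sup>2)" for j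
    unfolding sum.distrib[symmetric] by (intro sum.cong refl) (simp add: power2_diff algebra_simps)
  have level_weight: "level_weight k j * (fact j * a + fact j * b) = fact (k - Suc j) * (a + b)" for j and a b :: real
    by (simp add: level_weight_def field_simps)
  have "?T \<in> alt_tensors k" by (rule diag_tensor_alt_tensors) (rule f)
  from tensor_form_diag[OF this, of n x] show ?thesis
    unfolding first second level_weight square .
qed

text \<open>The potential \<open>f\<close> is, up to scaling, the one minimising the energy when \<open>y\<close> lies in the cone;
  the value of the form on it is a multiple of \<open>e\<^sub>k(y) e\<^sub>k\<^sub>-\<^sub>1(y)\<close> for all \<open>y\<close>.\<close>

lemma tensor_form_diag_tensor_dpoly:
  fixes x :: "nat \<Rightarrow> real" and s :: real
  assumes n: "d + k = n"
  defines "y \<equiv> \<lambda>i. x i + s"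
  defines "f \<equiv> \<lambda>S. if S \<subseteq> {..<n} then (\<Prod>i\<in>S. y i) * poly (dpoly x (Suc d) ({..<n} - S)) s else 0"
  shows "\<And>S. finite S \<Longrightarrow> k \<le> card S \<Longrightarrow> f S = 0"
    and "poly (dpoly x d {..<n}) s = 0 \<Longrightarrow> tensor_form n k (diag_fun y) (diag_tensor f) (diag_tensor f) = 0"
proof -
  define \<alpha> where "\<alpha> S = poly (dpoly x d S) s" for S
  define \<beta> where "\<beta> S = poly (dpoly x (Suc d) S) s" for S
  have \<beta>0: "\<beta> S = 0" if "finite S" "card S \<le> d" for S
    unfolding \<beta>_def using that by (subst dpoly_eq_0) auto
  show f0: "f S = 0" if "finite S" "k \<le> card S" for S
  proof (cases "S \<subseteq> {..<n}")
    case True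
    hence "card ({..<n} - S) \<le> d" using that n by (simp add: card_Diff_subset)
    thus ?thesis using \<beta>0[of "{..<n} - S"] by (simp add: f_def \<beta>_def)
  qed (simp add: f_def)
  assume zero: "poly (dpoly x d {..<n}) s = 0"
  define R where "R xs = {..<n} - set xs" for xs
  define P where "P xs = (\<Prod>i\<in>set xs. y i)" for xs
  define G where "G j = (\<Sum>xs\<in>dwords n j. (P xs)\<^sup>2 * (\<alpha> (R xs) * \<beta> (R xs)))" for j
  define g where "g j = (real d + 1) * fact j * G j" for j
  have step: "(\<Sum>xs\<in>dwords n j. \<Sum>u\<in>R xs. y u * (f (set xs) - f (insert u (set xs)))\<^sup>2)
    = (real (k - j) * g j - g (Suc j) / (real j + 1)) / fact j" if j: "j < k" for j
  proof -
    have "(\<Sum>xs\<in>dwords n j. \<Sum>u\<in>R xs. y u * (f (set xs) - f (insert u (set xs)))\<^sup>2)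
        + (real d + 1) * G (Suc j)
      = (\<Sum>xs\<in>dwords n j. \<Sum>u\<in>R xs. y u * (f (set xs) - f (insert u (set xs)))\<^sup>2
          + (real d + 1) * ((P (u # xs))\<^sup>2 * (\<alpha> (R (u # xs)) * \<beta> (R (u # xs)))))"
      by (simp add: G_def sum_dwords_Suc sum.distrib sum_distrib_left R_def)
    \<comment> \<open>Write \<alpha>' and \<beta>' for the values with u removed. The recursion for
      \<beta> makes the potential drop equal to (d + 1) P \<alpha>', so the edge has energy (d +
      1)^2 y_u (P \<alpha>')^2; adding (d + 1) (y_u P)^2 \<alpha>' \<beta>' reassembles \<beta>.
      This is an identity that holds for all signs.\<close>
    also have "\<dots> = (\<Sum>xs\<in>dwords n j. \<Sum>u\<in>R xs. (real d + 1) * (P xs)\<^sup>2 * \<beta> (R xs) * (y u * \<alpha> (R xs - {u})))"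
    proof (intro sum.cong refl)
      fix xs u assume xs: "xs \<in> dwords n j" and u: "u \<in> R xs"
      have sub: "set xs \<subseteq> {..<n}" using xs by (auto simp: dwords_def words_def)
      have RC: "R (u # xs) = R xs - {u}" by (auto simp: R_def)
      have PC: "P (u # xs) = y u * P xs" using u by (simp add: P_def R_def)
      have rec: "\<beta> (R xs) = y u * \<beta> (R xs - {u}) + (real d + 1) * \<alpha> (R xs - {u})"
        unfolding \<beta>_def \<alpha>_def y_def using u by (intro poly_dpoly_Suc) (auto simp: R_def)
      have "f (set xs) = P xs * \<beta> (R xs)" using sub by (simp add: f_def P_def \<beta>_def R_def)
      moreover have "f (insert u (set xs)) = y u * P xs * \<beta> (R xs - {u})"
      proof -
        have "{..<n} - insert u (set xs) = R xs - {u}" by (auto simp: R_def)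
        thus ?thesis using sub u by (simp add: f_def P_def \<beta>_def R_def)
      qed
      ultimately show "y u * (f (set xs) - f (insert u (set xs)))\<^sup>2
          + (real d + 1) * ((P (u # xs))\<^sup>2 * (\<alpha> (R (u # xs)) * \<beta> (R (u # xs))))
        = (real d + 1) * (P xs)\<^sup>2 * \<beta> (R xs) * (y u * \<alpha> (R xs - {u}))"
        unfolding RC PC rec by (simp add: algebra_simps power2_eq_square)
    qed
    also have "\<dots> = (\<Sum>xs\<in>dwords n j. (real d + 1) * (P xs)\<^sup>2 * \<beta> (R xs) * (\<Sum>u\<in>R xs. y u * \<alpha> (R xs - {u})))"
      by (simp add: sum_distrib_left)
    also have "\<dots> = (\<Sum>xs\<in>dwords n j. (real d + 1) * (P xs)\<^sup>2 * \<beta> (R xs) * (real (k - j) * \<alpha> (R xs)))"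
    proof (intro sum.cong refl arg_cong2[of _ _ _ _ "(*)"])
      fix xs assume xs: "xs \<in> dwords n j"
      have "card (R xs) = n - j"
        using xs by (simp add: R_def card_Diff_subset dwords_def words_def distinct_card)
      thus "(\<Sum>u\<in>R xs. y u * \<alpha> (R xs - {u})) = real (k - j) * \<alpha> (R xs)"
        using dpoly_Euler[of "R xs" x s d] n j by (simp add: \<alpha>_def y_def of_nat_diff R_def)
    qed
    also have "\<dots> = (real d + 1) * real (k - j) * G j"
      by (simp add: G_def sum_distrib_left mult_ac)
    finally have "(\<Sum>xs\<in>dwords n j. \<Sum>u\<in>R xs. y u * (f (set xs) - f (insert u (set xs)))\<^sup>2)
      = (real d + 1) * real (k - j) * G j - (real d + 1) * G (Suc j)" by linarith
    also have "\<dots> = (real (k - j) * g j - g (Suc j) / (real j + 1)) / fact j"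
      by (simp add: g_def diff_divide_distrib add.commute del: of_nat_diff)
    finally show ?thesis .
  qed
  have "tensor_form n k (diag_fun y) (diag_tensor f) (diag_tensor f)
    = (\<Sum>j<k. fact (k - Suc j) * (\<Sum>xs\<in>dwords n j. \<Sum>u\<in>R xs. y u * (f (set xs) - f (insert u (set xs)))\<^sup>2))"
    unfolding R_def by (rule tensor_form_diag_tensor[of k f, OF f0])
  also have "\<dots> = (\<Sum>j<k. level_weight k j * (real (k - j) * g j - g (Suc j) / (real j + 1)))"
    by (rule sum.cong[OF refl]) (simp add: step level_weight_def)
  also have "\<dots> = fact k * g 0 - g k / fact k"
    by (rule sum_fact_telescope)
  \<comment> \<open>The boundary term at the empty word has the value of the derivative at s as a
    factor, and this is where the assumed zero enters.\<close>
  also have "g 0 = 0"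
    using zero by (simp add: g_def G_def dwords_def \<alpha>_def R_def cong: conj_cong)
  also have "g k = 0"
  proof -
    have "\<beta> (R xs) = 0" if "xs \<in> dwords n k" for xs
      using that n by (intro \<beta>0) (auto simp: R_def card_Diff_subset dwords_def words_def distinct_card)
    thus ?thesis by (simp add: g_def G_def)
  qed
  finally show "tensor_form n k (diag_fun y) (diag_tensor f) (diag_tensor f) = 0" by simp
qed

text \<open>With unit conductances, zero energy makes the potential constant along all edges below
  level k. Every smaller subset can be enlarged one element at a time up to size k, where the
  potential is grounded, so the potential would vanish identically.\<close>

lemma tensor_form_one_diag_tensor_pos:
  assumes "k \<le> n" and f: "\<And>S. finite S \<Longrightarrow> k \<le> card S \<Longrightarrow> f S = 0"
    and S: "S \<subseteq> {..<n}" "f S \<noteq> 0"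
  shows "tensor_form n k (diag_fun (\<lambda>_. 1)) (diag_tensor f) (diag_tensor f) > 0"
proof (rule ccontr)
  let ?s = "\<lambda>j. \<Sum>xs\<in>dwords n j. \<Sum>u\<in>{..<n} - set xs. (f (set xs) - f (insert u (set xs)))\<^sup>2"
  assume "\<not> ?thesis"
  hence "(\<Sum>j<k. fact (k - Suc j) * ?s j) \<le> 0" by (simp add: tensor_form_diag_tensor[OF f])
  moreover have nonneg: "?s j \<ge> 0" for j by (intro sum_nonneg) auto
  ultimately have "(\<Sum>j<k. fact (k - Suc j) * ?s j) = 0"
    by (intro antisym sum_nonneg) auto
  hence "\<forall>j\<in>{..<k}. fact (k - Suc j) * ?s j = 0"
    using nonneg by (subst (asm) sum_nonneg_eq_0_iff) auto
  hence s0: "?s j = 0" if "j < k" for j using that by simp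
  have eq: "f (set xs) = f (insert u (set xs))" if "xs \<in> dwords n j" "j < k" "u < n" "u \<notin> set xs" for xs u j
  proof -
    have "\<forall>xs\<in>dwords n j. (\<Sum>u\<in>{..<n} - set xs. (f (set xs) - f (insert u (set xs)))\<^sup>2) = 0"
      using s0[OF that(2)] by (subst (asm) sum_nonneg_eq_0_iff) (auto intro: sum_nonneg)
    hence "(\<Sum>u\<in>{..<n} - set xs. (f (set xs) - f (insert u (set xs)))\<^sup>2) = 0" using that(1) by blast
    hence "\<forall>u\<in>{..<n} - set xs. (f (set xs) - f (insert u (set xs)))\<^sup>2 = 0"
      by (subst (asm) sum_nonneg_eq_0_iff) auto
    thus ?thesis using that by auto
  qed
  have *: "f (set xs) = 0" if "xs \<in> dwords n j" "j + m = k" for xs j m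
    using that
  proof (induction m arbitrary: xs j)
    case 0
    thus ?case by (intro f) (auto simp: dwords_def words_def distinct_card)
  next
    case (Suc m)
    have "card (set xs) < n" using Suc.prems \<open>k \<le> n\<close> by (simp add: dwords_def words_def distinct_card)
    hence "\<not> {..<n} \<subseteq> set xs" using card_mono[of "set xs" "{..<n}"] by auto
    then obtain u where u: "u < n" "u \<notin> set xs" by auto
    have "u # xs \<in> dwords n (Suc j)" using Suc.prems(1) u by (auto simp: dwords_def words_def)
    from Suc.IH[OF this] Suc.prems(2) have "f (insert u (set xs)) = 0" by simp
    thus ?case using eq[OF Suc.prems(1) _ u] Suc.prems(2) by simp
  qed
  have finS: "finite S" using S(1) finite_subset by blast
  obtain xs where xs: "distinct xs" "set xs = S"
    using finite_distinct_list[OF finS] by blast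
  have "card S < k" using f[OF finS] S(2) by (cases "card S < k") auto
  moreover have "length xs = card S" using xs distinct_card by metis
  moreover have "xs \<in> dwords n (length xs)" using xs S(1) by (simp add: dwords_def words_def)
  ultimately have "f S = 0"
    using *[of xs "length xs" "k - length xs"] xs by simp
  thus False using S by simp
qed

lemma tensor_form_diag_nonneg_imp:
  assumes n: "d + k = n" and nonneg: "\<And>T. T \<in> alt_tensors k \<Longrightarrow> tensor_form n k (diag_fun x) T T \<ge> 0" and s: "s > 0"
  shows "poly (dpoly x d {..<n}) s \<noteq> 0"
proof
  assume zero: "poly (dpoly x d {..<n}) s = 0"
  let ?y = "\<lambda>i. x i + s"
  define N where "N = {i \<in> {..<n}. ?y i \<noteq> 0}"
  \<comment> \<open>With fewer than \<open>k - 1\<close> nonzero coordinates the minimising potential vanishes identically, and the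
    indicator of the subsets of \<open>N\<close> takes its place.\<close>
  have "\<exists>f S. (\<forall>S. finite S \<longrightarrow> k \<le> card S \<longrightarrow> f S = 0) \<and> S \<subseteq> {..<n} \<and> f S \<noteq> 0
    \<and> tensor_form n k (diag_fun ?y) (diag_tensor f) (diag_tensor f) = 0"
  proof (cases "k \<le> Suc (card N)")
    case True
    have "k \<noteq> 0"
    proof
      assume "k = 0"
      hence "card {..<n} = d" using n by simp
      thus False using dpoly_top_pos[of "{..<n}" x s] zero by simp
    qed
    hence "k - 1 \<le> card N" using True by simp
    \<comment> \<open>With k - 1 elements removed, d + 1 variables remain, so the derivative of
      order d + 1 is a positive constant; choosing S inside N keeps the product nonzero.\<close>
    then obtain S where S: "S \<subseteq> N" "card S = k - 1"
      using obtain_subset_with_card_n by metis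
    let ?f = "\<lambda>S. if S \<subseteq> {..<n} then (\<Prod>i\<in>S. ?y i) * poly (dpoly x (Suc d) ({..<n} - S)) s else 0"
    have sub: "S \<subseteq> {..<n}" using S by (auto simp: N_def)
    have fin: "finite S" using sub finite_subset by blast
    have "card ({..<n} - S) = Suc d"
      using sub S n \<open>k \<noteq> 0\<close> by (simp add: card_Diff_subset fin)
    hence "poly (dpoly x (Suc d) ({..<n} - S)) s > 0"
      using dpoly_top_pos[of "{..<n} - S" x s] by simp
    moreover have "(\<Prod>i\<in>S. ?y i) \<noteq> 0" using fin S by (auto simp: N_def prod_zero_iff)
    ultimately have "?f S \<noteq> 0" using sub by simp
    thus ?thesis using tensor_form_diag_tensor_dpoly[OF n, where x = x and s = s] zero sub
      by (intro exI[of _ ?f] exI[of _ S]) blast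
  next
    case False
    let ?f = "\<lambda>S. if S \<subseteq> N then 1 else 0 :: real"
    have finN: "finite N" by (simp add: N_def)
    have f: "?f S = 0" if "finite S" "k \<le> card S" for S
      using card_mono[OF finN, of S] that False by auto
    \<comment> \<open>The indicator changes along an edge only when the added u lies outside N, and
      such an edge has conductance zero.\<close>
    have zero: "?y u * (?f (set xs) - ?f (insert u (set xs)))\<^sup>2 = 0" if "u \<in> {..<n} - set xs" for u xs
      using that by (cases "?y u = 0") (auto simp: N_def)
    have "tensor_form n k (diag_fun ?y) (diag_tensor ?f) (diag_tensor ?f) = (\<Sum>j<k. fact (k - Suc j) *
        (\<Sum>xs\<in>dwords n j. \<Sum>u\<in>{..<n} - set xs. ?y u * (?f (set xs) - ?f (insert u (set xs)))\<^sup>2))"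
      by (rule tensor_form_diag_tensor) (rule f)
    also have "\<dots> = (\<Sum>j<k. fact (k - Suc j) * (\<Sum>xs\<in>dwords n j. \<Sum>u\<in>{..<n} - set xs. 0))"
      by (intro sum.cong refl arg_cong2[of _ _ _ _ "(*)"] zero)
    finally have "tensor_form n k (diag_fun ?y) (diag_tensor ?f) (diag_tensor ?f) = 0" by simp
    thus ?thesis using f by (intro exI[of _ ?f] exI[of _ "{}"]) auto
  qed
  then obtain f S where f: "\<And>S. finite S \<Longrightarrow> k \<le> card S \<Longrightarrow> f S = 0" and S: "S \<subseteq> {..<n}" "f S \<noteq> 0"
    and form0: "tensor_form n k (diag_fun ?y) (diag_tensor f) (diag_tensor f) = 0" by blast
  have "tensor_form n k (diag_fun ?y) (diag_tensor f) (diag_tensor f)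
    = tensor_form n k (\<lambda>a b. diag_fun x a b + s * diag_fun (\<lambda>_. 1) a b) (diag_tensor f) (diag_tensor f)"
    by (intro arg_cong2[of _ _ _ _ "\<lambda>X T. tensor_form n k X T T"] ext) (auto simp: diag_fun_def)
  also have "\<dots> = tensor_form n k (diag_fun x) (diag_tensor f) (diag_tensor f) + s * tensor_form n k (diag_fun (\<lambda>_. 1)) (diag_tensor f) (diag_tensor f)"
    by (simp only: tensor_form_add_mat tensor_form_scale_mat)
  also have "\<dots> > 0"
  proof (intro add_nonneg_pos mult_pos_pos s)
    show "tensor_form n k (diag_fun x) (diag_tensor f) (diag_tensor f) \<ge> 0"
      by (intro nonneg diag_tensor_alt_tensors f)
    show "tensor_form n k (diag_fun (\<lambda>_. 1)) (diag_tensor f) (diag_tensor f) > 0"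
      using n by (intro tensor_form_one_diag_tensor_pos[of k n f S] f S) auto
  qed
  finally show False using form0 by simp
qed

text \<open>On the boundary of the cone the denominators of the ratios may vanish. Nonnegativity is
  therefore taken at the shifts x + s with s > 0 and passed to the limit, the form being affine in
  s.\<close>

lemma tensor_form_diag_nonneg_iff:
  assumes n: "d + k = n"
  shows "(\<forall>T\<in>alt_tensors k. tensor_form n k (diag_fun x) T T \<ge> 0) \<longleftrightarrow> (\<forall>s>0. poly (dpoly x d {..<n}) s \<noteq> 0)"
proof
  assume *: "\<forall>s>0. poly (dpoly x d {..<n}) s \<noteq> 0"
  have pos: "poly (dpoly x d {..<n}) s > 0" if "s > 0" for s
    using * that n by (intro dpoly_pos_if_nonzero) auto
  show "\<forall>T\<in>alt_tensors k. tensor_form n k (diag_fun x) T T \<ge> 0"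
  proof
    fix T assume T: "T \<in> alt_tensors k"
    let ?A = "tensor_form n k (diag_fun x) T T" and ?B = "tensor_form n k (diag_fun (\<lambda>_. 1)) T T"
    have ge: "?A + s * ?B \<ge> 0" if s: "s > 0" for s
    proof -
      have "tensor_form n k (diag_fun (\<lambda>i. x i + s)) T T \<ge> 0"
        by (rule tensor_form_diag_nonneg[OF n T]) (use pos s in auto)
      also have "diag_fun (\<lambda>i. x i + s) = (\<lambda>a b. diag_fun x a b + s * diag_fun (\<lambda>_. 1) a b)"
        by (intro ext) (auto simp: diag_fun_def)
      finally show ?thesis by (simp only: tensor_form_add_mat tensor_form_scale_mat)
    qed
    have "((\<lambda>s. ?A + s * ?B) \<longlongrightarrow> ?A + 0 * ?B) (at_right 0)"
      by (intro tendsto_intros)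
    moreover have "eventually (\<lambda>s. ?A + s * ?B \<ge> 0) (at_right 0)"
      using ge by (auto simp: eventually_at_right_less intro: eventually_at_rightI[of 0 1])
    ultimately have "0 \<le> ?A + 0 * ?B"
      by (rule tendsto_lowerbound) simp
    thus "?A \<ge> 0" by simp
  qed
next
  assume "\<forall>T\<in>alt_tensors k. tensor_form n k (diag_fun x) T T \<ge> 0"
  thus "\<forall>s>0. poly (dpoly x d {..<n}) s \<noteq> 0"
    using tensor_form_diag_nonneg_imp[OF n] by blast
qed

section \<open>Diagonalisation and the linear matrix inequality\<close>

lemma mult_mat_vec_index_sum:
  assumes "A \<in> carrier_mat n m" "v \<in> carrier_vec m" "i < n"
  shows "(A *\<^sub>v v) $ i = (\<Sum>j<m. A $$ (i,j) * v $ j)"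
  using assms by (simp add: scalar_prod_def atLeast0LessThan)

text \<open>For a complex eigenvector p + i q with eigenvalue k, evaluating q^T A p in two ways by
  symmetry gives Im k (|p|^2 + |q|^2) = 0. So k is real, and whichever of p and q is nonzero is a
  real eigenvector.\<close>

lemma real_symmetric_eigenvector:
  fixes A :: "real mat"
  assumes A: "A \<in> sym_mats n" and n: "n > 0"
  obtains v l where "v \<in> carrier_vec n" "v \<noteq> 0\<^sub>v n" "A *\<^sub>v v = l \<cdot>\<^sub>v v"
proof -
  have cA: "A \<in> carrier_mat n n" and tA: "transpose_mat A = A"
    using A by (auto simp: sym_mats_def)
  have symA: "A $$ (i,j) = A $$ (j,i)" if "i < n" "j < n" for i j
    using that cA arg_cong[OF tA, of "\<lambda>M. M $$ (i,j)"] by simp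
  define B where "B = map_mat complex_of_real A"
  have cB: "B \<in> carrier_mat n n" using cA by (simp add: B_def)
  from spectrum_non_empty[OF cB n] obtain k where "eigenvalue B k"
    by (auto simp: spectrum_def)
  then obtain v where cv: "v \<in> carrier_vec n" and v0: "v \<noteq> 0\<^sub>v n" and ev: "B *\<^sub>v v = k \<cdot>\<^sub>v v"
    using cB by (auto simp: eigenvalue_def eigenvector_def)
  define p q where "p = map_vec Re v" and "q = map_vec Im v"
  have cp: "p \<in> carrier_vec n" and cq: "q \<in> carrier_vec n"
    using cv by (auto simp: p_def q_def)
  have row: "(\<Sum>j<n. complex_of_real (A $$ (i,j)) * v $ j) = k * v $ i" if i: "i < n" for i
  proof -
    have "(B *\<^sub>v v) $ i = (\<Sum>j<n. B $$ (i,j) * v $ j)"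
      by (rule mult_mat_vec_index_sum[OF cB cv i])
    also have "\<dots> = (\<Sum>j<n. complex_of_real (A $$ (i,j)) * v $ j)"
      using cA i by (intro sum.cong) (auto simp: B_def)
    finally show ?thesis using ev cv i by simp
  qed
  have rp: "(\<Sum>j<n. A $$ (i,j) * p $ j) = Re k * p $ i - Im k * q $ i" if i: "i < n" for i
    using arg_cong[OF row[OF i], of Re] cv i by (simp add: p_def q_def)
  have rq: "(\<Sum>j<n. A $$ (i,j) * q $ j) = Re k * q $ i + Im k * p $ i" if i: "i < n" for i
    using arg_cong[OF row[OF i], of Im] cv i by (simp add: p_def q_def)
  have "(\<Sum>i<n. q $ i * (\<Sum>j<n. A $$ (i,j) * p $ j)) = (\<Sum>j<n. \<Sum>i<n. q $ i * (A $$ (i,j) * p $ j))"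
    unfolding sum_distrib_left by (rule sum.swap)
  also have "\<dots> = (\<Sum>j<n. p $ j * (\<Sum>i<n. A $$ (j,i) * q $ i))"
    by (auto simp: sum_distrib_left symA intro!: sum.cong)
  finally have "(\<Sum>i<n. q $ i * (Re k * p $ i - Im k * q $ i)) = (\<Sum>i<n. p $ i * (Re k * q $ i + Im k * p $ i))"
    by (simp add: rp rq)
  hence "Im k * (\<Sum>i<n. (p $ i)\<^sup>2 + (q $ i)\<^sup>2) = 0"
    by (simp add: algebra_simps sum.distrib sum_subtractf sum_distrib_left power2_eq_square)
  moreover have "(\<Sum>i<n. (p $ i)\<^sup>2 + (q $ i)\<^sup>2) \<noteq> 0"
  proof
    assume "(\<Sum>i<n. (p $ i)\<^sup>2 + (q $ i)\<^sup>2) = 0"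
    hence "\<forall>i<n. (p $ i)\<^sup>2 + (q $ i)\<^sup>2 = 0"
      by (subst (asm) sum_nonneg_eq_0_iff) auto
    hence "\<forall>i<n. v $ i = 0"
      using cv by (auto simp: p_def q_def complex_eq_iff)
    thus False using v0 cv by auto
  qed
  ultimately have k0: "Im k = 0" by simp
  have Ap: "A *\<^sub>v p = Re k \<cdot>\<^sub>v p" and Aq: "A *\<^sub>v q = Re k \<cdot>\<^sub>v q"
    using cA cp cq rp rq k0
    by (auto simp: mult_mat_vec_index_sum[OF cA cp] mult_mat_vec_index_sum[OF cA cq] simp del: index_mult_mat_vec intro!: eq_vecI)
  have "p \<noteq> 0\<^sub>v n \<or> q \<noteq> 0\<^sub>v n"
  proof (rule ccontr)
    assume "\<not> ?thesis"
    hence *: "p = 0\<^sub>v n" "q = 0\<^sub>v n" by auto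
    have "v $ i = 0" if "i < n" for i
      using arg_cong[OF *(1), of "\<lambda>w. w $ i"] arg_cong[OF *(2), of "\<lambda>w. w $ i"] cv that
      by (simp add: p_def q_def complex_eq_iff)
    thus False using v0 cv by auto
  qed
  thus ?thesis using that cp cq Ap Aq by blast
qed

text \<open>The Householder reflection exchanging \<open>v\<close> and the first unit vector.\<close>

lemma orthogonal_first_column:
  fixes v :: "real vec"
  assumes v: "v \<in> carrier_vec n" and n: "n > 0" and v1: "scalar_prod v v = 1"
  obtains H where "H \<in> carrier_mat n n" "transpose_mat H = H" "H * H = 1\<^sub>m n" "col H 0 = v"
proof -
  define w where "w i = v $ i - (if i = 0 then 1 else 0)" for i
  \<comment> \<open>If v is already the first unit vector, division by zero gives c = 0 and H
    becomes the identity, as it should.\<close>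
  define c where "c = 2 / (\<Sum>i<n. (w i)\<^sup>2)"
  define H where "H = mat n n (\<lambda>(i,j). (if i = j then 1 else 0) - c * w i * w j)"
  have vv: "(\<Sum>i<n. (v $ i)\<^sup>2) = 1"
    using v v1 by (simp add: scalar_prod_def atLeast0LessThan power2_eq_square)
  have "(\<Sum>i<n. (w i)\<^sup>2) = (\<Sum>i<n. (v $ i)\<^sup>2) - 2 * (\<Sum>i<n. (if i = 0 then v $ i else 0)) + (\<Sum>i<n. (if i = 0 then 1 else 0))"
    unfolding w_def sum_distrib_left sum_subtractf[symmetric] sum.distrib[symmetric]
    by (intro sum.cong) (auto simp: power2_eq_square algebra_simps)
  also have "\<dots> = - 2 * w 0"
    using n by (simp add: vv w_def)
  finally have ww: "(\<Sum>i<n. (w i)\<^sup>2) = - 2 * w 0" .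
  have cww: "c * c * (\<Sum>i<n. (w i)\<^sup>2) = 2 * c"
    by (cases "(\<Sum>i<n. (w i)\<^sup>2) = 0") (auto simp: c_def)
  have cw0: "c * w 0 * w i = - w i" if i: "i < n" for i
  proof (cases "w 0 = 0")
    case True
    have "\<forall>i\<in>{..<n}. (w i)\<^sup>2 = 0"
      by (subst sum_nonneg_eq_0_iff[symmetric]) (use ww True in auto)
    thus ?thesis using i by auto
  next
    case False
    thus ?thesis by (simp add: c_def ww)
  qed
  have cH: "H \<in> carrier_mat n n" by (simp add: H_def)
  have HH: "H * H = 1\<^sub>m n"
  proof (rule eq_matI)
    fix i j assume "i < dim_row (1\<^sub>m n :: real mat)" "j < dim_col (1\<^sub>m n :: real mat)"
    hence i: "i < n" and j: "j < n" by auto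
    have "(H * H) $$ (i,j) = (\<Sum>k<n. ((if i = k then 1 else 0) - c * w i * w k) * ((if k = j then 1 else 0) - c * w k * w j))"
      using i j by (simp add: H_def scalar_prod_def atLeast0LessThan)
    also have "\<dots> = (\<Sum>k<n. (if i = k then (if k = j then 1 else 0) else 0)) - (\<Sum>k<n. if i = k then c * w k * w j else 0)
       - (\<Sum>k<n. if k = j then c * w i * w k else 0) + w i * w j * (c * c * (\<Sum>k<n. (w k)\<^sup>2))"
      unfolding sum_distrib_left sum_subtractf[symmetric] sum.distrib[symmetric]
      by (intro sum.cong) (auto simp: power2_eq_square algebra_simps)
    also have "\<dots> = (if i = j then 1 else 0)"
      using i j by (simp add: cww)
    finally show "(H * H) $$ (i,j) = 1\<^sub>m n $$ (i,j)" using i j by simp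
  qed (auto simp: H_def)
  have "transpose_mat H = H"
    by (rule eq_matI) (auto simp: H_def)
  moreover have "col H 0 = v"
  proof (rule eq_vecI)
    fix i assume "i < dim_vec v"
    hence i: "i < n" using v by simp
    have "vec_index (col H 0) i = (if i = 0 then 1 else 0) - c * w 0 * w i"
      using i n by (simp add: H_def mult_ac)
    also have "\<dots> = v $ i" by (simp add: cw0[OF i]) (simp add: w_def)
    finally show "vec_index (col H 0) i = v $ i" .
  qed (use v cH in auto)
  ultimately show ?thesis using that cH HH by blast
qed

definition diagm :: "nat \<Rightarrow> (nat \<Rightarrow> real) \<Rightarrow> real mat" where
  "diagm n x = mat n n (\<lambda>(i,j). if i = j then x i else 0)"

text \<open>Conjugating by a reflection whose first column is a unit eigenvector clears the first
  column off the diagonal, hence by symmetry the first row; the induction hypothesis diagonalises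
  the remaining block.\<close>

theorem spectral_theorem_sym_mats:
  assumes "A \<in> sym_mats n"
  obtains U x where "U \<in> carrier_mat n n" "U * transpose_mat U = 1\<^sub>m n" "transpose_mat U * U = 1\<^sub>m n"
    "A = U * diagm n x * transpose_mat U"
proof -
  have "\<exists>U x. U \<in> carrier_mat n n \<and> U * transpose_mat U = 1\<^sub>m n \<and> transpose_mat U * U = 1\<^sub>m n
    \<and> A = U * diagm n x * transpose_mat U"
    using assms
  proof (induction n arbitrary: A)
    case 0
    hence "A = 1\<^sub>m 0 * diagm 0 (\<lambda>_. 0) * transpose_mat (1\<^sub>m 0)"
      by (intro eq_matI) (auto simp: sym_mats_def)
    thus ?case by (intro exI[of _ "1\<^sub>m 0"] exI[of _ "\<lambda>_. 0"]) auto
  next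
    case (Suc n)
    let ?T = "transpose_mat"
    have cA: "A \<in> carrier_mat (Suc n) (Suc n)" and tA: "?T A = A"
      using Suc.prems by (auto simp: sym_mats_def)
    obtain v0 l where v0: "v0 \<in> carrier_vec (Suc n)" "v0 \<noteq> 0\<^sub>v (Suc n)" "A *\<^sub>v v0 = l \<cdot>\<^sub>v v0"
      using real_symmetric_eigenvector[OF Suc.prems] by auto
    define c where "c = sqrt (scalar_prod v0 v0)"
    have "scalar_prod v0 v0 \<ge> 0" unfolding scalar_prod_def by (intro sum_nonneg) auto
    moreover have "scalar_prod v0 v0 \<noteq> 0"
    proof
      assume "scalar_prod v0 v0 = 0"
      hence "\<forall>i\<in>{0..<Suc n}. v0 $ i * v0 $ i = 0"
        using v0(1) by (subst sum_nonneg_eq_0_iff[symmetric]) (auto simp: scalar_prod_def)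
      hence "v0 = 0\<^sub>v (Suc n)" using v0(1) by (intro eq_vecI) auto
      thus False using v0(2) by simp
    qed
    ultimately have c: "c > 0" "c * c = scalar_prod v0 v0" by (auto simp: c_def)
    define v where "v = (1/c) \<cdot>\<^sub>v v0"
    have cv: "v \<in> carrier_vec (Suc n)" using v0(1) by (simp add: v_def)
    have v1: "scalar_prod v v = 1" using v0(1) c by (simp add: v_def flip: c(2))
    have Av: "A *\<^sub>v v = l \<cdot>\<^sub>v v"
      using cA v0 by (simp add: v_def mult_mat_vec[OF cA] smult_smult_assoc mult_ac)
    obtain H where cH: "H \<in> carrier_mat (Suc n) (Suc n)" and tH: "?T H = H" and HH: "H * H = 1\<^sub>m (Suc n)"
      and col: "col H 0 = v"
      using orthogonal_first_column[OF cv _ v1] by auto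
    define B where "B = H * A * H"
    have cB: "B \<in> carrier_mat (Suc n) (Suc n)" using cH cA by (simp add: B_def)
    have tB: "?T B = B"
      unfolding B_def using cH cA tH tA
      by (simp add: transpose_mult[of _ "Suc n" "Suc n" _ "Suc n"] assoc_mult_mat[of _ "Suc n" "Suc n" _ "Suc n" _ "Suc n"])
    have "col B 0 = (H * A) *\<^sub>v v"
      unfolding B_def using cH cA col by (subst col_mult2[of _ "Suc n" "Suc n" _ "Suc n"]) auto
    also have "\<dots> = H *\<^sub>v (l \<cdot>\<^sub>v v)"
      using cH cA cv by (simp add: assoc_mult_mat_vec[of _ "Suc n" "Suc n" _ "Suc n"] Av)
    also have "\<dots> = l \<cdot>\<^sub>v (H *\<^sub>v col H 0)"
      using cH cv by (simp add: mult_mat_vec col)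
    also have "H *\<^sub>v col H 0 = col (H * H) 0"
      using cH by (subst col_mult2[of _ "Suc n" "Suc n" _ "Suc n"]) auto
    finally have colB: "col B 0 = l \<cdot>\<^sub>v unit_vec (Suc n) 0"
      by (simp add: HH)
    have B0: "B $$ (i,0) = (if i = 0 then l else 0)" if "i < Suc n" for i
      using arg_cong[OF colB, of "\<lambda>w. w $ i"] that cB by simp
    have symB: "B $$ (i,j) = B $$ (j,i)" if "i < Suc n" "j < Suc n" for i j
      using that cB arg_cong[OF tB, of "\<lambda>M. M $$ (i,j)"] by simp
    define B' where "B' = mat n n (\<lambda>(i,j). B $$ (Suc i, Suc j))"
    have "B' \<in> sym_mats n"
      unfolding sym_mats_def B'_def by (auto intro!: eq_matI symB)
    from Suc.IH[OF this] obtain U x where cU: "U \<in> carrier_mat n n" and U1: "U * ?T U = 1\<^sub>m n"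
      and U2: "?T U * U = 1\<^sub>m n" and B'eq: "B' = U * diagm n x * ?T U" by blast
    have cD: "diagm n x \<in> carrier_mat n n" by (simp add: diagm_def)
    define bl where "bl a M = four_block_mat (a \<cdot>\<^sub>m 1\<^sub>m 1 :: real mat) (0\<^sub>m 1 n) (0\<^sub>m n 1) M" for a M
    have mult: "bl a M * bl b N = bl (a * b) (M * N)" if "M \<in> carrier_mat n n" "N \<in> carrier_mat n n" for a b M N
      unfolding bl_def using that by (subst mult_four_block_mat[of _ 1 1 _ n _ n _ _ 1 _ n]) (auto intro!: arg_cong2[of _ _ _ _ "\<lambda>a b. four_block_mat a _ _ b"] eq_matI)
    have tr: "?T (bl a M) = bl a (?T M)" if "M \<in> carrier_mat n n" for a M
      unfolding bl_def using that by (subst transpose_four_block_mat[of _ 1 1 _ n _ n]) (auto intro!: eq_matI)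
    have one: "bl 1 (1\<^sub>m n) = 1\<^sub>m (Suc n)"
      unfolding bl_def by (rule eq_matI) auto
    have cbl: "bl a M \<in> carrier_mat (Suc n) (Suc n)" if "M \<in> carrier_mat n n" for a M
      using that unfolding bl_def by auto
    define V where "V = bl 1 U"
    have cV: "V \<in> carrier_mat (Suc n) (Suc n)" unfolding V_def using cU by (rule cbl)
    have V1: "V * ?T V = 1\<^sub>m (Suc n)" and V2: "?T V * V = 1\<^sub>m (Suc n)"
      unfolding V_def using cU U1 U2 one by (simp_all add: tr mult)
    define y where "y = case_nat l x"
    have D: "diagm (Suc n) y = bl l (diagm n x)"
      unfolding bl_def by (rule eq_matI) (auto simp: diagm_def y_def split: nat.splits)
    have cDy: "diagm (Suc n) y \<in> carrier_mat (Suc n) (Suc n)" by (simp add: diagm_def)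
    have "B = bl l B'"
      unfolding bl_def by (rule eq_matI) (use cB B0 symB in \<open>auto simp: B'_def\<close>)
    also have "\<dots> = V * diagm (Suc n) y * ?T V"
      unfolding V_def D using cU cD by (simp add: tr mult B'eq)
    finally have Beq: "B = V * diagm (Suc n) y * ?T V" .
    note assoc = assoc_mult_mat[of _ "Suc n" "Suc n" _ "Suc n" _ "Suc n"]
    have [simp]: "H * (H * M) = M" if "M \<in> carrier_mat (Suc n) (Suc n)" for M
      using assoc[OF cH cH that] HH that by simp
    have [simp]: "V * (?T V * M) = M" "?T V * (V * M) = M" if "M \<in> carrier_mat (Suc n) (Suc n)" for M
      using assoc[of V "?T V" M] assoc[of "?T V" V M] V1 V2 cV that by simp_all
    have "A = H * B * H"
      unfolding B_def using cA cH by (simp add: assoc HH)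
    also have "\<dots> = (H * V) * diagm (Suc n) y * ?T (H * V)"
      unfolding Beq using cH cV cDy by (simp add: assoc transpose_mult[of _ "Suc n" "Suc n" _ "Suc n"] tH)
    finally have "A = (H * V) * diagm (Suc n) y * ?T (H * V)" .
    moreover have "(H * V) * ?T (H * V) = 1\<^sub>m (Suc n)" "?T (H * V) * (H * V) = 1\<^sub>m (Suc n)"
      using cH cV by (simp_all add: assoc transpose_mult[of _ "Suc n" "Suc n" _ "Suc n"] tH HH V2)
    ultimately show ?case using cH cV
      by (intro exI[of _ "H * V"] exI[of _ y]) auto
  qed
  thus ?thesis using that by blast
qed

section \<open>Reduction to a matrix inequality of finite size\<close>

text \<open>The space \<open>W\<close> may have infinite dimension, but its members are only
  compared on the finite set \<open>I\<close>. Coordinates are eliminated one by one: a member that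
  is nonzero at i serves as pivot, and subtracting multiples of it leaves the subspace of members
  vanishing at i.\<close>

lemma finite_spanning_family:
  fixes W :: "('i \<Rightarrow> real) set"
  assumes "finite I" and W: "\<And>f g c. f \<in> W \<Longrightarrow> g \<in> W \<Longrightarrow> (\<lambda>i. f i + c * g i) \<in> W"
  shows "\<exists>N w. (\<forall>s<N. w s \<in> W) \<and> (\<forall>f\<in>W. \<exists>c. \<forall>i\<in>I. f i = (\<Sum>s<(N::nat). c s * w s i))"
  using assms
proof (induction I arbitrary: W rule: finite_induct)
  case empty
  show ?case by (intro exI[of _ 0]) auto
next
  case (insert i I)
  show ?case
  proof (cases "\<forall>f\<in>W. f i = 0")
    case True
    obtain N w where w: "\<forall>s<(N::nat). w s \<in> W"
      and span: "\<And>f. f \<in> W \<Longrightarrow> \<exists>c. \<forall>i\<in>I. f i = (\<Sum>s<N. c s * w s i)"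
      using insert.IH[OF insert.prems] by blast
    have "\<exists>c. \<forall>j\<in>insert i I. f j = (\<Sum>s<N. c s * w s j)" if f: "f \<in> W" for f
    proof -
      obtain c where "\<forall>j\<in>I. f j = (\<Sum>s<N. c s * w s j)" using span[OF f] by blast
      moreover have "(\<Sum>s<N. c s * w s i) = 0" using True w by (intro sum.neutral) auto
      hence "f i = (\<Sum>s<N. c s * w s i)" using True f by simp
      ultimately show ?thesis by blast
    qed
    thus ?thesis using w by blast
  next
    case False
    then obtain w0 where w0: "w0 \<in> W" "w0 i \<noteq> 0" by blast
    define W' where "W' = {f \<in> W. f i = 0}"
    have "(\<lambda>i. f i + c * g i) \<in> W'" if "f \<in> W'" "g \<in> W'" for f g c
      using that insert.prems by (auto simp: W'_def)
    from insert.IH[OF this] obtain N w where w: "\<forall>s<(N::nat). w s \<in> W'"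
      and span: "\<And>f. f \<in> W' \<Longrightarrow> \<exists>c. \<forall>i\<in>I. f i = (\<Sum>s<N. c s * w s i)"
      by blast
    have "\<exists>c. \<forall>j\<in>insert i I. f j = (\<Sum>s<Suc N. c s * (w(N := w0)) s j)" if f: "f \<in> W" for f
    proof -
      define r where "r = f i / w0 i"
      have "(\<lambda>j. f j + (- r) * w0 j) \<in> W'"
        using insert.prems[OF f w0(1), of "- r"] w0(2) by (simp add: W'_def r_def)
      from span[OF this] obtain c where c: "\<forall>j\<in>I. f j + (- r) * w0 j = (\<Sum>s<N. c s * w s j)" by blast
      have sum: "(\<Sum>s<Suc N. (c(N := r)) s * (w(N := w0)) s j) = (\<Sum>s<N. c s * w s j) + r * w0 j" for j
        by simp
      have "f j = (\<Sum>s<Suc N. (c(N := r)) s * (w(N := w0)) s j)" if "j \<in> insert i I" for j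
      proof (cases "j = i")
        case True
        have "(\<Sum>s<N. c s * w s i) = 0" using w by (intro sum.neutral) (auto simp: W'_def)
        thus ?thesis unfolding sum True using w0(2) by (simp add: r_def)
      next
        case False
        hence "f j + (- r) * w0 j = (\<Sum>s<N. c s * w s j)" using that c by blast
        thus ?thesis unfolding sum by simp
      qed
      thus ?thesis by blast
    qed
    moreover have "\<forall>s<Suc N. (w(N := w0)) s \<in> W" using w w0 by (auto simp: W'_def less_Suc_eq)
    ultimately show ?thesis by blast
  qed
qed

lemma alternating_add: "alternating F \<Longrightarrow> alternating G \<Longrightarrow> alternating (\<lambda>xs. F xs + c * G xs)"
  by (simp add: alternating_def)

lemma alt_tensors_add:
  "T \<in> alt_tensors k \<Longrightarrow> T' \<in> alt_tensors k \<Longrightarrow> (\<lambda>xs ys. T xs ys + c * T' xs ys) \<in> alt_tensors k"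
  by (simp add: alt_tensors_def alternating_add)

lemma alt_tensors_sum:
  assumes "\<And>s. s < N \<Longrightarrow> w s \<in> alt_tensors k"
  shows "(\<lambda>xs ys. \<Sum>s<(N::nat). c s * w s xs ys) \<in> alt_tensors k"
  using assms
proof (induction N)
  case 0
  show ?case by (simp add: alt_tensors_def alternating_def)
next
  case (Suc N)
  thus ?case using alt_tensors_add[of "\<lambda>xs ys. \<Sum>s<N. c s * w s xs ys" k "w N" "c N"] by simp
qed

lemma spectrahedral_cone_tensor_form:
  "spectrahedral_cone n {A \<in> sym_mats n. \<forall>T\<in>alt_tensors k. tensor_form n k (\<lambda>a b. A $$ (a, b)) T T \<ge> 0}"
proof -
  define J where "J = (\<Union>j\<le>k. words n j)"
  have "finite (J \<times> J)" by (simp add: J_def)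
  moreover have "(\<lambda>i. f i + c * g i) \<in> {f. curry f \<in> alt_tensors k}"
    if "f \<in> {f. curry f \<in> alt_tensors k}" "g \<in> {f. curry f \<in> alt_tensors k}" for f g c
    using alt_tensors_add[of "curry f" k "curry g" c] that by (simp add: curry_def)
  ultimately obtain N w0 where w0: "\<forall>s<(N::nat). w0 s \<in> {f. curry f \<in> alt_tensors k}"
    and span0: "\<And>f. f \<in> {f. curry f \<in> alt_tensors k} \<Longrightarrow> \<exists>c. \<forall>i\<in>J \<times> J. f i = (\<Sum>s<N. c s * w0 s i)"
    using finite_spanning_family[of "J \<times> J" "{f. curry f \<in> alt_tensors k}"] by blast
  define w where "w s = curry (w0 s)" for s
  have w: "w s \<in> alt_tensors k" if "s < N" for s using w0 that by (simp add: w_def)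
  have span: "\<exists>c. \<forall>xs\<in>J. \<forall>ys\<in>J. T xs ys = (\<Sum>s<N. c s * w s xs ys)" if "T \<in> alt_tensors k" for T
    using span0[of "case_prod T"] that by (auto simp: w_def)
  define F where "F A s t = tensor_form n k (\<lambda>a b. A $$ (a, b)) (w s) (w t)" for A :: "real mat" and s t
  \<comment> \<open>The Gram matrix of the form in the spanning family is symmetrised, since
    \<open>cross_form\<close> is not symmetric; the quadratic form is unchanged.\<close>
  define L where "L A = mat N N (\<lambda>(s, t). (F A s t + F A t s) / 2)" for A
  have F_add: "F (A + B) s t = F A s t + F B s t" if "A \<in> sym_mats n" "B \<in> sym_mats n" for A B s t
    unfolding F_def tensor_form_add_mat[symmetric] using that by (intro tensor_form_cong) (auto simp: sym_mats_def)
  have F_smult: "F (c \<cdot>\<^sub>m A) s t = c * F A s t" if "A \<in> sym_mats n" for A c s t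
    unfolding F_def tensor_form_scale_mat[symmetric] using that by (intro tensor_form_cong) (auto simp: sym_mats_def)
  have L_sym: "L A \<in> sym_mats N" for A
    by (auto simp: L_def sym_mats_def add.commute intro!: eq_matI)
  have "linear_sym_map n N L"
    unfolding linear_sym_map_def
    by (auto simp: L_sym) (auto simp: L_def F_add F_smult add_divide_distrib algebra_simps intro!: eq_matI)
  moreover have "L A \<in> psd_mats N \<longleftrightarrow> (\<forall>T\<in>alt_tensors k. tensor_form n k (\<lambda>a b. A $$ (a, b)) T T \<ge> 0)" for A
  proof -
    let ?c = "\<lambda>v xs ys. \<Sum>s<N. v s * w s xs ys"
    have quad: "scalar_prod v (L A *\<^sub>v v) = tensor_form n k (\<lambda>a b. A $$ (a, b)) (?c (\<lambda>s. v $ s)) (?c (\<lambda>s. v $ s))"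
      if v: "v \<in> carrier_vec N" for v
    proof -
      have "scalar_prod v (L A *\<^sub>v v) = (\<Sum>s<N. v $ s * (\<Sum>t<N. (F A s t + F A t s) / 2 * v $ t))"
        using v by (simp add: scalar_prod_def L_def atLeast0LessThan)
      also have "\<dots> = (\<Sum>s<N. \<Sum>t<N. v $ s * v $ t * F A s t) / 2 + (\<Sum>s<N. \<Sum>t<N. v $ s * v $ t * F A t s) / 2"
        by (simp add: sum_distrib_left sum_divide_distrib sum.distrib[symmetric] field_simps)
      also have "(\<Sum>s<N. \<Sum>t<N. v $ s * v $ t * F A t s) = (\<Sum>t<N. \<Sum>s<N. v $ t * v $ s * F A t s)"
        by (subst sum.swap) (simp add: mult_ac)
      finally show ?thesis by (simp add: tensor_form_sum2 F_def)
    qed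
    show ?thesis
    proof
      assume psd: "L A \<in> psd_mats N"
      show "\<forall>T\<in>alt_tensors k. tensor_form n k (\<lambda>a b. A $$ (a, b)) T T \<ge> 0"
      proof
        fix T assume "T \<in> alt_tensors k"
        then obtain c where c: "\<forall>xs\<in>J. \<forall>ys\<in>J. T xs ys = ?c c xs ys" using span by blast
        have "0 \<le> scalar_prod (vec N c) (L A *\<^sub>v vec N c)" using psd by (simp add: psd_mats_def)
        also have "\<dots> = tensor_form n k (\<lambda>a b. A $$ (a, b)) (?c c) (?c c)"
          by (subst quad) simp_all
        also have "\<dots> = tensor_form n k (\<lambda>a b. A $$ (a, b)) T T"
          using c by (intro tensor_form_cong) (auto simp: J_def)
        finally show "tensor_form n k (\<lambda>a b. A $$ (a, b)) T T \<ge> 0" .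
      qed
    next
      assume "\<forall>T\<in>alt_tensors k. tensor_form n k (\<lambda>a b. A $$ (a, b)) T T \<ge> 0"
      thus "L A \<in> psd_mats N"
        using L_sym alt_tensors_sum[of N w k] w by (auto simp: psd_mats_def quad)
    qed
  qed
  ultimately show ?thesis
    unfolding spectrahedral_cone_def by (intro exI[of _ N] exI[of _ L]) auto
qed

section \<open>Passage to an eigenbasis\<close>

lemma conj_diagm_index:
  assumes "U \<in> carrier_mat n n" "a < n" "b < n"
  shows "(U * diagm n x * transpose_mat U) $$ (a, b) = (\<Sum>c<n. U $$ (a, c) * x c * U $$ (b, c))"
proof -
  have "(U * diagm n x) $$ (a, c) = U $$ (a, c) * x c" if "c < n" for c
  proof -
    have "(U * diagm n x) $$ (a, c) = (\<Sum>e<n. if e = c then U $$ (a, e) * x e else 0)"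
      using assms that by (simp add: diagm_def scalar_prod_def atLeast0LessThan if_distrib[of "(*) _"] cong: if_cong)
    thus ?thesis using that by simp
  qed
  hence "(\<Sum>c<n. (U * diagm n x) $$ (a, c) * U $$ (b, c)) = (\<Sum>c<n. U $$ (a, c) * x c * U $$ (b, c))"
    by (intro sum.cong) auto
  thus ?thesis
    using assms by (simp add: scalar_prod_def atLeast0LessThan diagm_def)
qed

lemma orthonormal_mat:
  assumes "U \<in> carrier_mat n n" "U * transpose_mat U = 1\<^sub>m n" "transpose_mat U * U = 1\<^sub>m n"
  shows "orthonormal n (\<lambda>a b. U $$ (a, b))"
proof -
  have "(\<Sum>a<n. U $$ (b, a) * U $$ (c, a)) = (if b = c then 1 else 0)" if "b < n" "c < n" for b c
    using arg_cong[OF assms(2), of "\<lambda>M. M $$ (b, c)"] assms(1) that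
    by (simp add: scalar_prod_def atLeast0LessThan)
  moreover have "(\<Sum>a<n. U $$ (a, b) * U $$ (a, c)) = (if b = c then 1 else 0)" if "b < n" "c < n" for b c
    using arg_cong[OF assms(3), of "\<lambda>M. M $$ (b, c)"] assms(1) that
    by (simp add: scalar_prod_def atLeast0LessThan)
  ultimately show ?thesis by (simp add: orthonormal_def)
qed

lemma tensor_form_conj_nonneg:
  assumes V: "orthonormal n V" and X: "\<And>a b. a < n \<Longrightarrow> b < n \<Longrightarrow> X a b = conj_mat n V Y a b"
    and Y: "\<forall>T\<in>alt_tensors k. tensor_form n k Y T T \<ge> 0"
  shows "\<forall>T\<in>alt_tensors k. tensor_form n k X T T \<ge> 0"
proof
  fix T assume T: "T \<in> alt_tensors k"
  have "tensor_form n k X T T = tensor_form n k (conj_mat n V Y) T T" by (intro tensor_form_cong X) auto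
  also have "\<dots> = tensor_form n k Y (act2 n V T) (act2 n V T)" by (rule tensor_form_act2[OF V, symmetric])
  also have "\<dots> \<ge> 0" using Y act2_alt_tensors[OF T] by blast
  finally show "tensor_form n k X T T \<ge> 0" .
qed

lemma conj_diag: "conj_mat n V (diag_fun x) a b = (\<Sum>c<n. V a c * x c * V b c)"
proof -
  have "(\<Sum>d<n. V a c * diag_fun x c d * V b d) = V a c * x c * V b c" if "c < n" for c
    using sum_diag[OF that, of x "\<lambda>d. V a c * V b d"] by (simp add: mult_ac)
  thus ?thesis by (simp add: conj_mat_def)
qed

lemma conj_transpose_conj:
  assumes V: "orthonormal n V" and "a < n" "b < n"
  shows "conj_mat n (\<lambda>a b. V b a) (conj_mat n V X) a b = X a b"
proof -
  have "conj_mat n (\<lambda>a b. V b a) (conj_mat n V X) a b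
    = (\<Sum>c<n. \<Sum>d<n. \<Sum>e<n. \<Sum>g<n. (V c a * V c e) * (V d b * V d g) * X e g)"
    by (simp add: conj_mat_def sum_distrib_left sum_distrib_right mult_ac)
  also have "\<dots> = (\<Sum>e<n. \<Sum>g<n. \<Sum>c<n. \<Sum>d<n. (V c a * V c e) * (V d b * V d g) * X e g)"
    by (rule sum4_rotate)
  also have "\<dots> = (\<Sum>e<n. \<Sum>g<n. (\<Sum>c<n. V c a * V c e) * (\<Sum>d<n. V d b * V d g) * X e g)"
    by (simp only: sum_product) (simp only: sum_distrib_right)
  also have "\<dots> = (\<Sum>e<n. \<Sum>g<n. (if a = e then if b = g then X e g else 0 else 0))"
    using assms by (intro sum.cong refl) (auto simp: orthonormal_def)
  also have "\<dots> = (\<Sum>e<n. if a = e then X e b else 0)"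
    using assms by (intro sum.cong refl) auto
  also have "\<dots> = X a b" using assms by simp
  finally show ?thesis .
qed

lemma orthonormal_transpose: "orthonormal n V \<Longrightarrow> orthonormal n (\<lambda>a b. V b a)"
  by (simp add: orthonormal_def)

section \<open>Derivatives of the determinant in the identity direction\<close>

text \<open>The derivative at a point depends only on the values along the line through it in
  direction of the identity, so the induction has to carry all points of that line at once.\<close>

lemma dir_deriv_funpow_line:
  fixes C :: "real mat"
  assumes C: "C \<in> carrier_mat n n" and f: "\<And>s. f (C + s \<cdot>\<^sub>m 1\<^sub>m n) = poly p s"
  shows "(dir_deriv (1\<^sub>m n) ^^ d) f (C + s \<cdot>\<^sub>m 1\<^sub>m n) = poly ((pderiv ^^ d) p) s"
proof (induction d arbitrary: s)
  case 0
  show ?case by (simp add: f)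
next
  case (Suc d)
  have eq: "C + s \<cdot>\<^sub>m 1\<^sub>m n + t \<cdot>\<^sub>m 1\<^sub>m n = C + (s + t) \<cdot>\<^sub>m 1\<^sub>m n" for t
    using C by (intro eq_matI) (auto simp: algebra_simps)
  have "((\<lambda>t. poly ((pderiv ^^ d) p) (s + t)) has_real_derivative poly (pderiv ((pderiv ^^ d) p)) (s + 0) * (0 + 1)) (at 0)"
    by (rule DERIV_chain'[OF _ poly_DERIV]) (auto intro!: derivative_eq_intros)
  hence "deriv (\<lambda>t. poly ((pderiv ^^ d) p) (s + t)) 0 = poly (pderiv ((pderiv ^^ d) p)) s"
    by (intro DERIV_imp_deriv) simp
  thus ?case
    by (simp only: funpow.simps o_apply dir_deriv_def[of "1\<^sub>m n" "(dir_deriv (1\<^sub>m n) ^^ d) f"] eq Suc.IH)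
qed

lemma det_char_diag:
  assumes U: "U \<in> carrier_mat n n" "U * transpose_mat U = 1\<^sub>m n" "transpose_mat U * U = 1\<^sub>m n"
    and A: "A = U * diagm n x * transpose_mat U"
  shows "Determinant.det (- A + s \<cdot>\<^sub>m 1\<^sub>m n) = poly (dpoly (\<lambda>i. - x i) 0 {..<n}) s"
proof -
  let ?D = "diagm n (\<lambda>i. - x i + s)"
  have cA: "A \<in> carrier_mat n n" and cD: "?D \<in> carrier_mat n n" using U by (auto simp: A diagm_def)
  have "- A + s \<cdot>\<^sub>m 1\<^sub>m n = U * ?D * transpose_mat U"
  proof (rule eq_matI)
    fix a b assume "a < dim_row (U * ?D * transpose_mat U)" "b < dim_col (U * ?D * transpose_mat U)"
    hence ab: "a < n" "b < n" using U by auto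
    have "(U * ?D * transpose_mat U) $$ (a, b) = - (\<Sum>c<n. U $$ (a, c) * x c * U $$ (b, c)) + s * (\<Sum>c<n. U $$ (a, c) * U $$ (b, c))"
      unfolding conj_diagm_index[OF U(1) ab] sum_negf[symmetric] sum_distrib_left sum.distrib[symmetric]
      by (intro sum.cong refl) (simp add: algebra_simps)
    also have "\<dots> = - A $$ (a, b) + s * (if a = b then 1 else 0)"
      using conj_diagm_index[OF U(1) ab] orthonormal_mat[OF U] ab by (simp add: A orthonormal_def)
    finally show "(- A + s \<cdot>\<^sub>m 1\<^sub>m n) $$ (a, b) = (U * ?D * transpose_mat U) $$ (a, b)"
      using ab cA by simp
  qed (use U cA in auto)
  hence "Determinant.det (- A + s \<cdot>\<^sub>m 1\<^sub>m n) = Determinant.det U * Determinant.det ?D * Determinant.det (transpose_mat U)"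
    using U cD by (simp add: det_mult[of _ n])
  also have "\<dots> = Determinant.det ?D"
    using arg_cong[OF U(2), of Determinant.det] U(1) by (simp add: det_mult[of _ n])
  also have "\<dots> = prod_list (diag_mat ?D)"
    by (rule det_upper_triangular[of _ n]) (auto simp: diagm_def)
  also have "\<dots> = (\<Prod>i<n. - x i + s)"
    by (simp add: diag_mat_def diagm_def prod.distinct_set_conv_list[symmetric] atLeast0LessThan cong: map_cong)
  finally show ?thesis by (simp add: poly_dpoly_0)
qed

text \<open>This reconciles two conventions: the hyperbolicity cone is defined through t I - A, the
  positivity results through A + s I with s = - t. Each linear factor and each differentiation
  contributes one sign.\<close>

lemma poly_dpoly_uminus:
  "poly (dpoly (\<lambda>i. - x i) d S) t = (- 1) ^ (card S + d) * poly (dpoly x d S) (- t)"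
proof -
  have *: "(pderiv ^^ d) (smult c (pcompose p [:0, -1:])) = smult (c * (- 1) ^ d) (pcompose ((pderiv ^^ d) p) [:0, -1:])"
    for c :: real and p
    by (induction d) (simp_all add: pderiv_smult pderiv_pcompose pderiv_pCons)
  have "(\<Prod>i\<in>S. [:- x i, 1:]) = smult ((- 1) ^ card S) (pcompose (\<Prod>i\<in>S. [:x i, 1:]) [:0, -1:])"
  proof (induction S rule: infinite_finite_induct)
    case (insert a S)
    have "[:- x a, 1:] = smult (- 1) (pcompose [:x a, 1:] [:0, -1:])" by (simp add: pcompose_pCons)
    thus ?case
      by (simp only: prod.insert[OF insert.hyps] insert.IH pcompose_mult mult_smult_left mult_smult_right
        smult_smult card_insert_disjoint[OF insert.hyps] power_Suc mult.commute)
  qed simp_all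
  thus ?thesis by (simp add: dpoly_def * poly_pcompose power_add)
qed

theorem corollary5p12:
  fixes n d :: nat
  assumes "d \<le> n"
  shows "spectrahedral_cone n (hyperbolicity_cone n ((dir_deriv (1\<^sub>m n) ^^ d) Determinant.det))"
proof -
  define k where "k = n - d"
  have n: "d + k = n" using assms by (simp add: k_def)
  have "(\<forall>T\<in>alt_tensors k. tensor_form n k (\<lambda>a b. A $$ (a, b)) T T \<ge> 0)
      \<longleftrightarrow> (\<forall>t. (dir_deriv (1\<^sub>m n) ^^ d) Determinant.det (t \<cdot>\<^sub>m 1\<^sub>m n - A) = 0 \<longrightarrow> t \<ge> 0)"
    if A: "A \<in> sym_mats n" for A
  proof -
    obtain U x where U: "U \<in> carrier_mat n n" "U * transpose_mat U = 1\<^sub>m n" "transpose_mat U * U = 1\<^sub>m n"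
      and AU: "A = U * diagm n x * transpose_mat U"
      using spectral_theorem_sym_mats[OF A] by blast
    let ?V = "\<lambda>a b. U $$ (a, b)"
    have cA: "A \<in> carrier_mat n n" using A by (simp add: sym_mats_def)
    have V: "orthonormal n ?V" by (rule orthonormal_mat[OF U])
    have AV: "A $$ (a, b) = conj_mat n ?V (diag_fun x) a b" if "a < n" "b < n" for a b
      using conj_diagm_index[OF U(1) that] by (simp add: AU conj_diag)
    \<comment> \<open>Nonnegativity is only transported from a matrix to its conjugates, so the
      converse implication conjugates back by the transpose.\<close>
    have "diag_fun x a b = conj_mat n (\<lambda>a b. ?V b a) (\<lambda>a b. A $$ (a, b)) a b" if "a < n" "b < n" for a b
    proof -
      have "conj_mat n (\<lambda>a b. ?V b a) (\<lambda>a b. A $$ (a, b)) a b = conj_mat n (\<lambda>a b. ?V b a) (conj_mat n ?V (diag_fun x)) a b"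
        unfolding conj_mat_def[of n "\<lambda>a b. ?V b a"] by (intro sum.cong refl) (simp add: AV)
      thus ?thesis using conj_transpose_conj[OF V that] by simp
    qed
    hence "(\<forall>T\<in>alt_tensors k. tensor_form n k (\<lambda>a b. A $$ (a, b)) T T \<ge> 0)
      \<longleftrightarrow> (\<forall>T\<in>alt_tensors k. tensor_form n k (diag_fun x) T T \<ge> 0)"
      using tensor_form_conj_nonneg[OF V AV] tensor_form_conj_nonneg[OF orthonormal_transpose[OF V]] by blast
    also have "\<dots> \<longleftrightarrow> (\<forall>s>0. poly (dpoly x d {..<n}) s \<noteq> 0)"
      by (rule tensor_form_diag_nonneg_iff[OF n])
    also have "\<dots> \<longleftrightarrow> (\<forall>t. poly (dpoly x d {..<n}) (- t) = 0 \<longrightarrow> t \<ge> 0)"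
      by (metis minus_minus neg_0_less_iff_less not_le)
    also have "\<dots> \<longleftrightarrow> (\<forall>t. (dir_deriv (1\<^sub>m n) ^^ d) Determinant.det (t \<cdot>\<^sub>m 1\<^sub>m n - A) = 0 \<longrightarrow> t \<ge> 0)"
    proof -
      have "(dir_deriv (1\<^sub>m n) ^^ d) Determinant.det (t \<cdot>\<^sub>m 1\<^sub>m n - A) = (- 1) ^ (n + d) * poly (dpoly x d {..<n}) (- t)" for t
      proof -
        have "t \<cdot>\<^sub>m 1\<^sub>m n - A = - A + t \<cdot>\<^sub>m 1\<^sub>m n" using cA by (intro eq_matI) auto
        hence "(dir_deriv (1\<^sub>m n) ^^ d) Determinant.det (t \<cdot>\<^sub>m 1\<^sub>m n - A) = poly ((pderiv ^^ d) (dpoly (\<lambda>i. - x i) 0 {..<n})) t"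
          using dir_deriv_funpow_line[of "- A" n Determinant.det] det_char_diag[OF U AU] cA by simp
        also have "\<dots> = poly (dpoly (\<lambda>i. - x i) d {..<n}) t" by (simp add: dpoly_def)
        finally show ?thesis by (simp add: poly_dpoly_uminus)
      qed
      thus ?thesis by simp
    qed
    finally show ?thesis .
  qed
  hence "hyperbolicity_cone n ((dir_deriv (1\<^sub>m n) ^^ d) Determinant.det)
    = {A \<in> sym_mats n. \<forall>T\<in>alt_tensors k. tensor_form n k (\<lambda>a b. A $$ (a, b)) T T \<ge> 0}"
    unfolding hyperbolicity_cone_def by blast
  thus ?thesis using spectrahedral_cone_tensor_form by simp
qed

end
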